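(* Let $\boldsymbol u_1,\boldsymbol u_2\in\mathbb R^d$ be two boost steps of magnitudes $u_1,u_2$ (nonzero, less than $c$) with angle $\varphi$ between them, let $\gamma_i=(1-u_i^2/c^2)^{-1/2}$, and suppose the two-step transport $W=w(\boldsymbol u_2)w(\boldsymbol u_1)$ has admissible endpoint. Then the rotation $R$ in its holonomy $D=\rho\begin{pmatrix}1&0\\0&R\end{pmatrix}$ has angle $$\theta=\tfrac14(\gamma_1-1)(\gamma_2-1)\sin2\varphi+O(M^6)=\frac{u_1^2u_2^2}{16c^4}\sin2\varphi+O(M^6)$$ (as the Mach number $M=\max(u_1,u_2)/c\to0$): it vanishes identically for collinear and for perpendicular steps and is maximal at $\varphi=\pi/4$. In particular the boost-pair rotation is $O(M^4)$, parametrically smaller than the $O(M^2)$ Thomas--Wigner rotation of a pure Lorentz boost pair.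
   Context: Fix $c>0$ and $d\in\{2,3\}$; coordinates $(t,\boldsymbol x)\in\mathbb R^{1+d}$, index $0$ for $t$. For $|\boldsymbol v|<c$ let $\gamma=(1-|\boldsymbol v|^2/c^2)^{-1/2}$, $\hat{\boldsymbol v}=\boldsymbol v/|\boldsymbol v|$; define linear maps (identified with matrices) $g(\boldsymbol v):(t,\boldsymbol x)\mapsto(t,\boldsymbol x-\boldsymbol vt)$, the Lorentz boost $\ell(\boldsymbol v):(t,\boldsymbol x)\mapsto\bigl(\gamma(t-\boldsymbol v\cdot\boldsymbol x/c^2),\ \boldsymbol x+(\gamma-1)(\hat{\boldsymbol v}\cdot\boldsymbol x)\hat{\boldsymbol v}-\gamma\boldsymbol vt\bigr)$, and $w(\boldsymbol v)=\ell(-\boldsymbol v)g(\boldsymbol v)$. $Q_*=\begin{pmatrix}1&0\\0&-c^2I\end{pmatrix}$. For $C$ symmetric with $A=C-\boldsymbol v\boldsymbol v^{\mathrm T}\succ0$ ("admissible"), put $Q(\boldsymbol v,C)=\begin{pmatrix}1&\boldsymbol v^{\mathrm T}\\ \boldsymbol v&\boldsymbol v\boldsymbol v^{\mathrm T}-C\end{pmatrix}$ and $w_3(\boldsymbol v,C)=\begin{pmatrix}p&\boldsymbol q^{\mathrm T}\\0&S\end{pmatrix}$, $S=cA^{-1/2}$, $p=(1+\boldsymbol v^{\mathrm T}A^{-1}\boldsymbol v)^{-1/2}$, $\boldsymbol q=pA^{-1}\boldsymbol v$. For $W=w(\boldsymbol u_2)w(\boldsymbol u_1)$ let $Q_{\mathrm{end}}=W^{-1}Q_*W^{-\mathrm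 T}$, $q_{00}=(Q_{\mathrm{end}})_{00}$; admissible endpoint means $q_{00}>0$ and $Q_{\mathrm{end}}/q_{00}=Q(\boldsymbol v,C)$ with $(\boldsymbol v,C)$ admissible. The holonomy is $D=W\,w_3(\boldsymbol v,C)^{-1}=\rho\begin{pmatrix}1&0\\0&R\end{pmatrix}$, $\rho=q_{00}^{-1/2}$, $R\in SO(d)$. The angle $\theta$ of $R$ is that of a rotation in the plane of $\boldsymbol u_1,\boldsymbol u_2$, counted positive in the sense from $\boldsymbol u_1$ to $\boldsymbol u_2$. The Thomas--Wigner rotation is the rotation factor when a product of two pure boosts $\ell(\boldsymbol u_2)\ell(\boldsymbol u_1)$ is written as a rotation times a pure boost.
   Formalization: The angle θ is not exactly maximal at φ=π/4 (it is still increasing there); what is proved is that the leading term is strictly maximal at φ=π/4 and that the φ maximizing the true θ at given magnitudes tends to π/4 as M→0. *)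

theory Defs
  imports "HOL-Analysis.Analysis" "HOL-Library.Landau_Symbols"
begin

text \<open>
  Space is \<^typ>\<open>real^'n\<close> with \<open>CARD('n) = d\<close>, and spacetime \<open>\<real>\<^bsup>1+d\<^esup>\<close> is
  \<^typ>\<open>real^('n::finite) option\<close>, the coordinate \<^term>\<open>None\<close> being time (index 0) and \<^term>\<open>Some j\<close>
  the spatial coordinate \<open>j\<close>.
\<close>

definition event :: "real \<Rightarrow> real^'n \<Rightarrow> real^('n::finite) option" where
  "event t x = (\<chi> i. case i of None \<Rightarrow> t | Some j \<Rightarrow> x $ j)"

definition time_of :: "real^('n::finite) option \<Rightarrow> real" where
  "time_of X = X $ None"

definition space_of :: "real^('n::finite) option \<Rightarrow> real^'n" where
  "space_of X = (\<chi> j. X $ Some j)"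

text \<open>The block matrix with rows \<open>(a, b\<^sup>T)\<close> and \<open>(e, S)\<close>.\<close>

definition block :: "real \<Rightarrow> real^'n \<Rightarrow> real^'n \<Rightarrow> real^'n^'n \<Rightarrow> real^('n::finite) option^('n::finite) option" where
  "block a b e S = (\<chi> i j. case i of
       None \<Rightarrow> (case j of None \<Rightarrow> a | Some l \<Rightarrow> b $ l)
     | Some k \<Rightarrow> (case j of None \<Rightarrow> e $ k | Some l \<Rightarrow> S $ k $ l))"

definition outer :: "real^'n \<Rightarrow> real^'n \<Rightarrow> real^'n^'n" where
  "outer v w = (\<chi> i j. v $ i * w $ j)"

definition pos_def :: "real^'n^'n \<Rightarrow> bool" where
  "pos_def A \<longleftrightarrow> transpose A = A \<and> (\<forall>x. x \<noteq> 0 \<longrightarrow> 0 < x \<bullet> (A *v x))"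

text \<open>\<open>A\<^bsup>-1/2\<^esup>\<close> for positive definite \<open>A\<close>.\<close>

definition inv_sqrt :: "real^'n^'n \<Rightarrow> real^'n^'n" where
  "inv_sqrt A = (THE S. pos_def S \<and> S ** S = matrix_inv A)"


definition lorentz_factor :: "real \<Rightarrow> real^'n \<Rightarrow> real" where
  "lorentz_factor c v = 1 / sqrt (1 - (norm v)\<^sup>2 / c\<^sup>2)"

definition galilei :: "real^'n \<Rightarrow> real^('n::finite) option^('n::finite) option" where
  "galilei v = matrix (\<lambda>X. event (time_of X) (space_of X - time_of X *\<^sub>R v))"

text \<open>At \<open>v = 0\<close> the unit vector \<^term>\<open>sgn v\<close> is \<open>0\<close>, and the boost is the identity.\<close>

definition lorentz_boost :: "real \<Rightarrow> real^'n \<Rightarrow> real^('n::finite) option^('n::finite) option" where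
  "lorentz_boost c v = matrix (\<lambda>X.
     let t = time_of X; x = space_of X; \<gamma> = lorentz_factor c v in
     event (\<gamma> * (t - (v \<bullet> x) / c\<^sup>2))
           (x + ((\<gamma> - 1) * (sgn v \<bullet> x)) *\<^sub>R sgn v - (\<gamma> * t) *\<^sub>R v))"

definition w_step :: "real \<Rightarrow> real^'n \<Rightarrow> real^('n::finite) option^('n::finite) option" where
  "w_step c v = lorentz_boost c (- v) ** galilei v"

definition Q_star :: "real \<Rightarrow> real^('n::finite) option^('n::finite) option" where
  "Q_star c = block 1 0 0 (- (c\<^sup>2) *\<^sub>R mat 1)"

definition admissible :: "real^'n \<Rightarrow> real^'n^'n \<Rightarrow> bool" where
  "admissible v C \<longleftrightarrow> transpose C = C \<and> pos_def (C - outer v v)"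

definition Q_of :: "real^'n \<Rightarrow> real^'n^'n \<Rightarrow> real^('n::finite) option^('n::finite) option" where
  "Q_of v C = block 1 v v (outer v v - C)"

definition w3 :: "real \<Rightarrow> real^'n \<Rightarrow> real^'n^'n \<Rightarrow> real^('n::finite) option^('n::finite) option" where
  "w3 c v C =
    (let A = C - outer v v;
         p = 1 / sqrt (1 + v \<bullet> (matrix_inv A *v v))
     in block p (p *\<^sub>R (matrix_inv A *v v)) 0 (c *\<^sub>R inv_sqrt A))"


definition transport :: "real \<Rightarrow> real^'n \<Rightarrow> real^'n \<Rightarrow> real^('n::finite) option^('n::finite) option" where
  "transport c u1 u2 = w_step c u2 ** w_step c u1"

definition Q_end :: "real \<Rightarrow> real^'n \<Rightarrow> real^'n \<Rightarrow> real^('n::finite) option^('n::finite) option" where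
  "Q_end c u1 u2 =
    matrix_inv (transport c u1 u2) ** Q_star c ** transpose (matrix_inv (transport c u1 u2))"

definition q00 :: "real \<Rightarrow> real^'n \<Rightarrow> real^'n \<Rightarrow> real" where
  "q00 c u1 u2 = Q_end c u1 u2 $ None $ None"

definition is_endpoint :: "real \<Rightarrow> real^'n \<Rightarrow> real^'n \<Rightarrow> real^'n \<Rightarrow> real^'n^'n \<Rightarrow> bool" where
  "is_endpoint c u1 u2 v C \<longleftrightarrow>
     admissible v C \<and> (1 / q00 c u1 u2) *\<^sub>R Q_end c u1 u2 = Q_of v C"

definition admissible_endpoint :: "real \<Rightarrow> real^'n \<Rightarrow> real^'n \<Rightarrow> bool" where
  "admissible_endpoint c u1 u2 \<longleftrightarrow> 0 < q00 c u1 u2 \<and> (\<exists>v C. is_endpoint c u1 u2 v C)"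

text \<open>The pair \<open>(v, C)\<close> is unique, because \<^const>\<open>Q_of\<close> is injective.\<close>

definition holonomy :: "real \<Rightarrow> real^'n \<Rightarrow> real^'n \<Rightarrow> real^('n::finite) option^('n::finite) option" where
  "holonomy c u1 u2 =
    (let (v, C) = (THE (v, C). is_endpoint c u1 u2 v C)
     in transport c u1 u2 ** matrix_inv (w3 c v C))"

definition rho :: "real \<Rightarrow> real^'n \<Rightarrow> real^'n \<Rightarrow> real" where
  "rho c u1 u2 = 1 / sqrt (q00 c u1 u2)"

definition holonomy_rotation :: "real \<Rightarrow> real^'n \<Rightarrow> real^'n \<Rightarrow> real^'n^'n" where
  "holonomy_rotation c u1 u2 = (THE R. holonomy c u1 u2 = rho c u1 u2 *\<^sub>R block 1 0 0 R)"


text \<open>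
  \<open>R\<close> rotates by \<open>\<theta>\<close> in the plane of \<open>u1\<close> and \<open>u2\<close>, positively from \<open>u1\<close> to \<open>u2\<close>, and fixes the
  orthogonal complement of that plane. The plane is oriented by an orthonormal basis
  \<open>(e1, e2)\<close> with \<open>e1\<close> along \<open>u1\<close> and \<open>u2\<close> in the half-plane \<open>e2 \<ge> 0\<close>. The basis is unique if
  \<open>u1\<close> and \<open>u2\<close> are linearly independent. For collinear \<open>u1\<close> and \<open>u2\<close> any plane through their
  line is allowed; the angle is then still unique (namely 0) if \<open>R\<close> is the identity.
\<close>

definition plane_rotation :: "real^'n \<Rightarrow> real^'n \<Rightarrow> real^'n^'n \<Rightarrow> real \<Rightarrow> bool" where
  "plane_rotation u1 u2 R \<theta> \<longleftrightarrow>
    (\<exists>e1 e2. norm e1 = 1 \<and> norm e2 = 1 \<and> e1 \<bullet> e2 = 0 \<and>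
       u1 = norm u1 *\<^sub>R e1 \<and> (\<exists>a b. 0 \<le> b \<and> u2 = a *\<^sub>R e1 + b *\<^sub>R e2) \<and>
       R *v e1 = cos \<theta> *\<^sub>R e1 + sin \<theta> *\<^sub>R e2 \<and>
       R *v e2 = - sin \<theta> *\<^sub>R e1 + cos \<theta> *\<^sub>R e2 \<and>
       (\<forall>x. x \<bullet> e1 = 0 \<and> x \<bullet> e2 = 0 \<longrightarrow> R *v x = x))"

definition rotation_angle :: "real^'n \<Rightarrow> real^'n \<Rightarrow> real^'n^'n \<Rightarrow> real" where
  "rotation_angle u1 u2 R = (THE \<theta>. - pi < \<theta> \<and> \<theta> \<le> pi \<and> plane_rotation u1 u2 R \<theta>)"

definition holonomy_angle :: "real \<Rightarrow> real^'n \<Rightarrow> real^'n \<Rightarrow> real" where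
  "holonomy_angle c u1 u2 = rotation_angle u1 u2 (holonomy_rotation c u1 u2)"

definition thomas_wigner_rotation :: "real \<Rightarrow> real^'n \<Rightarrow> real^'n \<Rightarrow> real^'n^'n" where
  "thomas_wigner_rotation c u1 u2 =
    (THE R. rotation_matrix R \<and>
       (\<exists>w. norm w < c \<and>
          lorentz_boost c u2 ** lorentz_boost c u1 = block 1 0 0 R ** lorentz_boost c w))"

definition thomas_wigner_angle :: "real \<Rightarrow> real^'n \<Rightarrow> real^'n \<Rightarrow> real" where
  "thomas_wigner_angle c u1 u2 = rotation_angle u1 u2 (thomas_wigner_rotation c u1 u2)"


definition angle_between :: "real^'n \<Rightarrow> real^'n \<Rightarrow> real" where
  "angle_between u1 u2 = arccos ((u1 \<bullet> u2) / (norm u1 * norm u2))"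

definition mach :: "real \<Rightarrow> real^'n \<Rightarrow> real^'n \<Rightarrow> real" where
  "mach c u1 u2 = max (norm u1) (norm u2) / c"

definition steps :: "real \<Rightarrow> ((real^'n) \<times> (real^'n)) set" where
  "steps c = {(u1, u2). u1 \<noteq> 0 \<and> u2 \<noteq> 0 \<and> norm u1 < c \<and> norm u2 < c}"

definition admissible_steps :: "real \<Rightarrow> ((real^'n) \<times> (real^'n)) set" where
  "admissible_steps c = {(u1, u2) \<in> steps c. admissible_endpoint c u1 u2}"

text \<open>
  The limit \<open>M \<rightarrow> 0\<close> over the pairs in \<open>S\<close>. Nothing else is held fixed, so Landau symbols along
  this filter are uniform in the directions of the steps and in the ratio of their magnitudes.
\<close>

definition mach_to_0 ::
  "real \<Rightarrow> ((real^'n) \<times> (real^'n)) set \<Rightarrow> ((real^'n) \<times> (real^'n)) filter" where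
  "mach_to_0 c S = inf (filtercomap (\<lambda>(u1, u2). mach c u1 u2) (nhds 0)) (principal S)"

definition leading_angle :: "real \<Rightarrow> real \<Rightarrow> real \<Rightarrow> real" where
  "leading_angle \<gamma>1 \<gamma>2 \<phi> = 1/4 * (\<gamma>1 - 1) * (\<gamma>2 - 1) * sin (2 * \<phi>)"

text \<open>The pairs whose holonomy angle is largest among all pairs with the same two magnitudes.\<close>

definition maximizing_steps :: "real \<Rightarrow> ((real^'n) \<times> (real^'n)) set" where
  "maximizing_steps c = {(u1 :: real^'n, u2) \<in> admissible_steps c.
     \<forall>(u1' :: real^'n, u2') \<in> admissible_steps c. norm u1' = norm u1 \<and> norm u2' = norm u2 \<longrightarrow>
       holonomy_angle c u1' u2' \<le> holonomy_angle c u1 u2}"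

end

theory Submission
  imports Defs
begin

text \<open>
  The step \<open>w(u)\<close> is block upper triangular with spatial block \<open>B(u) = 1 + (\<gamma> - 1) n n\<^sup>T\<close>, where \<open>n\<close> is
  the direction of \<open>u\<close>. Hence \<open>W\<close> is block triangular with spatial block \<open>M = B(u2) B(u1)\<close>, and since
  \<open>w\<^sub>3\<close> of the endpoint is block triangular with positive definite spatial block, the rotation \<open>R\<close> is
  the orthogonal factor of the polar decomposition \<open>M = R S\<close>. In the plane of the two steps this is a
  computation with \<open>2 \<times> 2\<close> matrices: with \<open>k\<^sub>i = \<gamma>\<^sub>i - 1\<close>,
  \<open>tan \<theta> = k\<^sub>1 k\<^sub>2 sin \<phi> cos \<phi> / (2 + k\<^sub>1 + k\<^sub>2 + k\<^sub>1 k\<^sub>2 cos\<^sup>2 \<phi>)\<close>. As \<open>k\<^sub>i = u\<^sub>i\<^sup>2 / 2 c\<^sup>2 + O(M\<^sup>4)\<close>, everything about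
  \<open>\<theta>\<close> follows from this formula. The Thomas--Wigner angle is \<open>2 arctan (Y / X)\<close> with
  \<open>Y = s\<^sub>1 s\<^sub>2 sin \<phi>\<close> and \<open>X = sqrt ((1 + s\<^sub>1\<^sup>2) (1 + s\<^sub>2\<^sup>2)) + s\<^sub>1 s\<^sub>2 cos \<phi>\<close>, where \<open>s\<^sub>i\<^sup>2 = k\<^sub>i / 2\<close>; it is comparable
  to \<open>u\<^sub>1 u\<^sub>2 sin \<phi> / c\<^sup>2\<close>, uniformly in the directions.
\<close>

section \<open>Block matrices and polar decomposition\<close>

text \<open>The endpoint form determines the stretch \<open>S\<close> but not the rotation, because
  \<open>R\<close> cancels in \<open>W^-1 Q_* W^-T\<close>; this is why all of \<open>R\<close>
  survives in the holonomy. The limit \<open>mach_to_0\<close> fixes neither the directions nor the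
  ratio of the speeds, so the constants in the estimates along it must be independent of both. In
  particular sin \<phi> is kept as a factor in the bounds for both angles: they vanish together for
  collinear steps, and only the retained factor allows a uniform comparison. The formula for tan
  \<theta> is not largest exactly at \<pi>/4, but where
  \<open>tan^2 \<phi> = 1 + k1 k2 / (2 + k1 + k2)\<close>. Maximality therefore splits into strict
  maximality of the leading term and convergence of the true maximizers to \<pi>/4. The latter
  compares with a pair at \<pi>/4, whose endpoint must be admissible; \<open>M < 1/8\<close> secures
  that.\<close>

lemma matrix_inv_eqI:
  fixes A :: "real^'n^'n"
  assumes "A ** B = mat 1"
  shows "matrix_inv A = B"
proof -
  have BA: "B ** A = mat 1"
    using assms by (simp add: matrix_left_right_inverse)
  have "A ** matrix_inv A = mat 1 \<and> matrix_inv A ** A = mat 1"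
    unfolding matrix_inv_def by (rule someI[of _ B]) (use assms BA in blast)
  then have "B ** (A ** matrix_inv A) = B" by simp
  then show ?thesis
    by (simp add: matrix_mul_assoc BA)
qed

lemma matrix_mul_scaleR_left: "(k *\<^sub>R A) ** B = k *\<^sub>R (A ** B)" for A :: "real^'m^'n"
  by (simp add: scalar_matrix_assoc)

lemma matrix_mul_scaleR_right: "A ** (k *\<^sub>R B) = k *\<^sub>R (A ** B)" for A :: "real^'m^'n"
  by (simp add: matrix_scalar_ac scalar_matrix_assoc)

lemma matrix_vector_mult_minus: "A *v (- x) = - (A *v x)" for A :: "real^'m^'n"
  using matrix_vector_mult_scaleR[of A "-1" x] by simp

lemma vector_matrix_mult_scaleR: "x v* (k *\<^sub>R A) = k *\<^sub>R (x v* A)" for A :: "real^'m^'n"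
  by (simp add: vec_eq_iff vector_matrix_mult_def sum_distrib_left mult_ac)

lemma outer_scaleR_left: "outer (k *\<^sub>R v) w = k *\<^sub>R outer v w"
  by (simp add: outer_def vec_eq_iff)

lemma outer_scaleR_right: "outer v (k *\<^sub>R w) = k *\<^sub>R outer v w"
  by (simp add: outer_def vec_eq_iff)

lemma outer_mult_vec: "outer v w *v x = (w \<bullet> x) *\<^sub>R v"
  by (simp add: outer_def vec_eq_iff matrix_vector_mult_def inner_vec_def sum_distrib_right
      sum_distrib_left ac_simps)

lemma outer_zero [simp]: "outer 0 w = 0" "outer v 0 = 0"
  by (simp_all add: outer_def vec_eq_iff)

lemma transpose_outer: "transpose (outer v w) = outer w v"
  by (simp add: outer_def vec_eq_iff transpose_def)

lemma transpose_add: "transpose (A + B) = transpose A + transpose B"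
  by (simp add: vec_eq_iff transpose_def)

lemma transpose_diff: "transpose (A - B) = transpose A - transpose B" for A :: "real^'m^'n"
  by (simp add: vec_eq_iff transpose_def)

lemma sum_UNIV_option: "(\<Sum>i\<in>UNIV. f i) = f None + (\<Sum>j\<in>UNIV. f (Some j))"
  for f :: "'n::finite option \<Rightarrow> real"
  by (simp add: UNIV_option_conv sum.reindex)

lemma block_mult:
  "block a b e S ** block a' b' e' S' =
     block (a * a' + b \<bullet> e') (a *\<^sub>R b' + b v* S') (a' *\<^sub>R e + S *v e') (outer e b' + S ** S')"
  by (auto simp: vec_eq_iff block_def matrix_matrix_mult_def matrix_vector_mult_def
      vector_matrix_mult_def outer_def inner_vec_def sum_UNIV_option mult.commute
      split: option.splits)

lemma transpose_block: "transpose (block a b e S) = block a e b (transpose S)"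
  by (auto simp: vec_eq_iff block_def transpose_def split: option.splits)

lemma block_eq_iff: "block a b e S = block a' b' e' S' \<longleftrightarrow> a = a' \<and> b = b' \<and> e = e' \<and> S = S'"
proof
  assume eq: "block a b e S = block a' b' e' S'"
  have entry: "block a b e S $ i $ j = block a' b' e' S' $ i $ j" for i j
    by (simp add: eq)
  show "a = a' \<and> b = b' \<and> e = e' \<and> S = S'"
    using entry[of None None] entry[of None "Some _"] entry[of "Some _" None]
      entry[of "Some _" "Some _"]
    by (simp add: vec_eq_iff block_def)
qed simp

lemma scaleR_block: "k *\<^sub>R block a b e S = block (k * a) (k *\<^sub>R b) (k *\<^sub>R e) (k *\<^sub>R S)"
  by (auto simp: vec_eq_iff block_def split: option.splits)

lemma mat_1_block: "(mat 1 :: real^('n::finite) option^'n option) = block 1 0 0 (mat 1)"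
  by (auto simp: vec_eq_iff block_def mat_def split: option.splits)

lemma block_time_time: "block a b e S $ None $ None = a"
  by (simp add: block_def)

section \<open>Positive definite matrices and uniqueness of their square roots\<close>

lemma pos_def_symmetric: "pos_def A \<Longrightarrow> transpose A = A"
  by (simp add: pos_def_def)

lemma pos_def_scaleR: "pos_def A \<Longrightarrow> 0 < k \<Longrightarrow> pos_def (k *\<^sub>R A)"
  by (auto simp: pos_def_def transpose_scalar scaleR_matrix_vector_assoc[symmetric])

lemma pos_def_mult_inv:
  fixes S :: "real^'n^'n"
  assumes "pos_def S"
  shows "S ** matrix_inv S = mat 1" "matrix_inv S ** S = mat 1"
proof -
  have "S *v x = 0 \<Longrightarrow> x = 0" for x
    using assms unfolding pos_def_def by (metis inner_zero_right less_irrefl)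
  then obtain B where B: "B ** S = mat 1"
    using matrix_left_invertible_ker[of S] by blast
  then have "S ** B = mat 1" by (simp add: matrix_left_right_inverse)
  with B show "S ** matrix_inv S = mat 1" "matrix_inv S ** S = mat 1"
    using matrix_inv_eqI by metis+
qed

lemma pos_def_inv_symmetric:
  assumes "pos_def S"
  shows "transpose (matrix_inv S) = matrix_inv S"
proof -
  have "S ** transpose (matrix_inv S) = transpose (matrix_inv S ** S)"
    using assms by (simp add: matrix_transpose_mul pos_def_symmetric)
  also have "\<dots> = mat 1" using assms by (simp add: pos_def_mult_inv)
  finally show ?thesis using matrix_inv_eqI by metis
qed

lemma symmetric_inner_swap:
  fixes S :: "real^'n^'n"
  assumes "transpose S = S"
  shows "x \<bullet> (S *v y) = (S *v x) \<bullet> y"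
  by (metis assms dot_lmul_matrix transpose_matrix_vector)

lemma symmetric_vec_mult:
  fixes S :: "real^'n^'n"
  assumes "transpose S = S"
  shows "x v* S = S *v x"
  by (metis assms transpose_matrix_vector)

lemma pos_def_square:
  fixes S :: "real^'n^'n"
  assumes "transpose S = S" "invertible S"
  shows "pos_def (S ** S)"
proof -
  have "0 < x \<bullet> ((S ** S) *v x)" if "x \<noteq> 0" for x
  proof -
    have "S *v x \<noteq> 0"
      using inj_matrix_vector_mult[OF assms(2)] that
      by (metis injD matrix_vector_mult_0_right)
    moreover have "x \<bullet> ((S ** S) *v x) = (S *v x) \<bullet> (S *v x)"
      using symmetric_inner_swap[OF assms(1)] by (simp add: matrix_vector_mul_assoc[symmetric])
    ultimately show ?thesis by simp
  qed
  then show ?thesis by (simp add: pos_def_def matrix_transpose_mul assms(1))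
qed

text \<open>For symmetric \<open>X\<close> rows and columns agree, so each diagonal entry of
  \<open>X S X\<close> is the quadratic form of \<open>S\<close> at a row of \<open>X\<close>. With
  \<open>S\<close> positive definite, a vanishing trace then kills \<open>X\<close> row by
  row.\<close>

lemma trace_congruence:
  fixes X S :: "real^'n^'n"
  assumes "transpose X = X"
  shows "trace (X ** S ** X) = (\<Sum>j\<in>UNIV. (X $ j) \<bullet> (S *v (X $ j)))"
proof -
  have "(X ** S ** X) $ j $ j = (X $ j) \<bullet> (S *v (X $ j))" for j
  proof -
    have "(X ** S ** X) $ j $ j = (\<Sum>k\<in>UNIV. (\<Sum>l\<in>UNIV. X $ j $ l * S $ l $ k) * X $ k $ j)"
      by (simp add: matrix_matrix_mult_def)
    also have "\<dots> = (\<Sum>k\<in>UNIV. (\<Sum>l\<in>UNIV. X $ j $ l * S $ l $ k) * X $ j $ k)"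
      using assms by (simp add: transpose_def vec_eq_iff)
    also have "\<dots> = (X $ j v* S) \<bullet> X $ j"
      by (simp add: inner_vec_def vector_matrix_mult_def)
    finally show ?thesis by (simp add: dot_lmul_matrix)
  qed
  then show ?thesis by (simp add: trace_def)
qed

text \<open>With \<open>X = S - T\<close>, the equation \<open>S X + X T = 0\<close> gives \<open>tr (X S X) + tr (X T X) = 0\<close>.\<close>

lemma pos_def_sqrt_unique:
  fixes S T :: "real^'n^'n"
  assumes S: "pos_def S" and T: "pos_def T" and eq: "S ** S = T ** T"
  shows "S = T"
proof -
  define X where "X = S - T"
  have sym: "transpose X = X"
    using S T by (simp add: X_def transpose_diff pos_def_symmetric)
  have "S ** X + X ** T = 0"
    unfolding matrix_eq X_def using eq[unfolded matrix_eq]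
    by (simp add: matrix_vector_mul_assoc[symmetric] algebra_simps)
  then have "X ** (S ** X) + X ** (X ** T) = 0"
    by (simp flip: matrix_add_ldistrib)
  then have "trace (X ** (S ** X)) + trace (X ** (X ** T)) = 0"
    using trace_0 by (simp flip: trace_add)
  moreover have "trace (X ** (X ** T)) = trace (X ** T ** X)"
    by (rule trace_mul_sym)
  ultimately have "trace (X ** S ** X) + trace (X ** T ** X) = 0"
    by (simp add: matrix_mul_assoc)
  then have "(\<Sum>j\<in>UNIV. (X $ j) \<bullet> (S *v (X $ j)) + (X $ j) \<bullet> (T *v (X $ j))) = 0"
    by (simp add: trace_congruence[OF sym] sum.distrib)
  moreover have pos: "x \<noteq> 0 \<Longrightarrow> 0 < x \<bullet> (S *v x) + x \<bullet> (T *v x)" for x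
    using S T by (simp add: pos_def_def add_pos_pos)
  then have "0 \<le> (X $ j) \<bullet> (S *v (X $ j)) + (X $ j) \<bullet> (T *v (X $ j))" for j
    by (cases "X $ j = 0") (auto intro: less_imp_le)
  ultimately have "(X $ j) \<bullet> (S *v (X $ j)) + (X $ j) \<bullet> (T *v (X $ j)) = 0" for j
    by (simp add: sum_nonneg_eq_0_iff)
  then have "X $ j = 0" for j
    using pos[of "X $ j"] by force
  then have "X = 0" by (simp add: vec_eq_iff)
  then show ?thesis by (simp add: X_def)
qed

text \<open>Uniqueness of the positive definite root turns the definite description in
  \<open>inv_sqrt\<close> into a check of an exhibited root.\<close>

lemma inv_sqrt_eqI:
  assumes "pos_def T" "T ** T = matrix_inv A"
  shows "inv_sqrt A = T"
  unfolding inv_sqrt_def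
proof (rule the_equality)
  show "pos_def T \<and> T ** T = matrix_inv A" using assms by blast
  show "S = T" if "pos_def S \<and> S ** S = matrix_inv A" for S
    using that assms by (auto intro: pos_def_sqrt_unique[of S T])
qed

section \<open>Endpoint and holonomy of a transport in polar form\<close>

lemma is_endpoint_unique:
  assumes "is_endpoint c u1 u2 v C" "is_endpoint c u1 u2 v' C'"
  shows "v = v'" "C = C'"
proof -
  from assms have "Q_of v C = Q_of v' C'" by (simp add: is_endpoint_def)
  then show "v = v'" "C = C'" by (auto simp: Q_of_def block_eq_iff)
qed

context
  fixes c a :: real and u1 u2 b :: "real^'n::finite" and R S :: "real^'n^'n"
  assumes c: "0 < c" and a: "0 < a" and S: "pos_def S" and R: "orthogonal_matrix R"
    and W: "transport c u1 u2 = block a b 0 (R ** S)"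
begin

lemma orthogonal_inverse: "transpose R ** R = mat 1" "R ** transpose R = mat 1"
  using R by (simp_all add: orthogonal_matrix_def)

text \<open>The spatial block of \<open>W^-1\<close> is \<open>N = T R^T\<close> with
  \<open>T = S^-1\<close>, and \<open>N N^T = T T\<close> since \<open>R^T R = 1\<close>. The same
  cancellation occurs in the mixed entries \<open>N z\<close>, and in the corner because
  \<open>R\<close> preserves norms.\<close>

lemma Q_end_polar:
  defines "T \<equiv> matrix_inv S"
  shows "Q_end c u1 u2 = block ((1 - c\<^sup>2 * (norm (T *v b))\<^sup>2) / a\<^sup>2)
     ((c\<^sup>2 / a) *\<^sub>R (T *v (T *v b))) ((c\<^sup>2 / a) *\<^sub>R (T *v (T *v b))) (- (c\<^sup>2) *\<^sub>R (T ** T))"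
proof -
  have ST: "S ** T = mat 1" "T ** S = mat 1" and symT: "transpose T = T"
    unfolding T_def using S by (simp_all add: pos_def_mult_inv pos_def_inv_symmetric)
  define N where "N = T ** transpose R"
  have MN: "R ** S ** N = mat 1"
    by (metis N_def orthogonal_inverse(2) ST(1) matrix_mul_assoc matrix_mul_rid)
  have NN: "N ** transpose N = T ** T"
    by (metis N_def orthogonal_inverse(1) matrix_mul_assoc matrix_mul_rid matrix_transpose_mul symT transpose_transpose)
  have tN: "transpose N = R ** T" by (simp add: N_def matrix_transpose_mul symT)
  define z where "z = - (1 / a) *\<^sub>R (b v* N)"
  have inv: "matrix_inv (transport c u1 u2) = block (1 / a) z 0 N"
    using a MN by (intro matrix_inv_eqI)
      (simp add: W block_mult mat_1_block[where 'n = 'n] block_eq_iff z_def)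
  have z: "z = - (1 / a) *\<^sub>R (R *v (T *v b))"
    by (metis z_def tN matrix_vector_mul_assoc transpose_matrix_vector)
  have normR: "norm (R *v x) = norm x" for x
  proof -
    have "(R *v x) \<bullet> (R *v x) = x \<bullet> x"
      by (metis orthogonal_inverse(1) dot_lmul_matrix matrix_vector_mul_assoc matrix_vector_mul_lid
          transpose_matrix_vector)
    then show ?thesis by (simp add: norm_eq_sqrt_inner)
  qed
  have zz: "z \<bullet> z = (norm (T *v b))\<^sup>2 / a\<^sup>2"
    by (simp add: z dot_square_norm normR power2_eq_square)
  have RRv: "transpose R *v (R *v x) = x" for x
    by (metis orthogonal_inverse(1) matrix_vector_mul_assoc matrix_vector_mul_lid)
  have Nz: "N *v z = - (1 / a) *\<^sub>R (T *v (T *v b))"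
    using RRv by (simp add: z N_def matrix_vector_mul_assoc[symmetric] matrix_vector_mult_scaleR
        matrix_vector_mult_minus del: transpose_matrix_vector)
  define k where "k = - (c\<^sup>2)"
  have "Q_end c u1 u2 = block (1 / a) (k *\<^sub>R z) 0 (k *\<^sub>R N) ** block (1 / a) 0 z (transpose N)"
    unfolding Q_end_def inv Q_star_def transpose_block k_def[symmetric]
    by (simp add: block_mult vector_matrix_mult_scaleR matrix_mul_scaleR_right)
  also have "\<dots> = block (1 / a * (1 / a) + k * (z \<bullet> z)) (k *\<^sub>R (N *v z)) (k *\<^sub>R (N *v z)) (k *\<^sub>R (T ** T))"
    unfolding block_mult block_eq_iff
    by (simp add: matrix_mul_scaleR_left NN[symmetric] scaleR_matrix_vector_assoc[symmetric]
        scaleR_vector_matrix_assoc matrix_vector_mult_scaleR)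
  also have "k *\<^sub>R (N *v z) = (c\<^sup>2 / a) *\<^sub>R (T *v (T *v b))"
    by (simp add: Nz k_def)
  also have "1 / a * (1 / a) + k * (z \<bullet> z) = (1 - c\<^sup>2 * (norm (T *v b))\<^sup>2) / a\<^sup>2"
    using a by (simp add: zz k_def field_simps power2_eq_square)
  finally show ?thesis by (simp only: k_def)
qed

lemma q00_polar: "q00 c u1 u2 = (1 - c\<^sup>2 * (norm (matrix_inv S *v b))\<^sup>2) / a\<^sup>2"
  by (simp add: q00_def Q_end_polar block_time_time)

text \<open>Comparison with \<open>Q_of\<close> forces \<open>A = (c^2/q) T T\<close>, which is
  positive definite once \<open>q > 0\<close>. Then \<open>c A^(-1/2) = sqrt q S\<close>, and the
  first row of \<open>w3\<close> becomes \<open>sqrt q (a, b)\<close>. So \<open>w3\<close> is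
  \<open>sqrt q\<close> times \<open>W\<close> with \<open>R\<close> deleted, and the quotient is
  \<open>diag(1, R) / sqrt q\<close>.\<close>

lemma endpoint_polar:
  assumes q: "0 < q00 c u1 u2"
  shows "admissible_endpoint c u1 u2"
    and "holonomy c u1 u2 = rho c u1 u2 *\<^sub>R block 1 0 0 R"
    and "holonomy_rotation c u1 u2 = R"
proof -
  define q T where "q = q00 c u1 u2" and "T = matrix_inv S"
  have q0: "0 < q" using assms by (simp add: q_def)
  have ST: "S ** T = mat 1" "T ** S = mat 1" and symT: "transpose T = T"
    unfolding T_def using S by (simp_all add: pos_def_mult_inv pos_def_inv_symmetric)
  define v where "v = (c\<^sup>2 / (q * a)) *\<^sub>R (T *v (T *v b))"
  define A where "A = (c\<^sup>2 / q) *\<^sub>R (T ** T)"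
  define C where "C = A + outer v v"
  have invT: "invertible T" unfolding invertible_def using ST by blast
  have posA: "pos_def A"
    unfolding A_def using c q0 by (intro pos_def_scaleR pos_def_square symT invT) auto
  have CA: "C - outer v v = A" by (simp add: C_def)
  have "admissible v C"
    unfolding admissible_def CA using posA
    by (simp add: C_def transpose_add transpose_outer pos_def_symmetric)
  moreover have "(1 / q00 c u1 u2) *\<^sub>R Q_end c u1 u2 = Q_of v C"
  proof -
    have "outer v v - C = - A" by (simp add: C_def)
    moreover have "Q_end c u1 u2 = block q ((c\<^sup>2 / a) *\<^sub>R (T *v (T *v b)))
      ((c\<^sup>2 / a) *\<^sub>R (T *v (T *v b))) (- (c\<^sup>2) *\<^sub>R (T ** T))"
      by (simp add: Q_end_polar q_def q00_polar T_def)
    ultimately show ?thesis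
      using q0 by (simp add: Q_of_def scaleR_block block_eq_iff q_def[symmetric] v_def A_def)
  qed
  ultimately have ep: "is_endpoint c u1 u2 v C" by (simp add: is_endpoint_def)
  then show "admissible_endpoint c u1 u2"
    using q by (auto simp: admissible_endpoint_def)
  have the: "(THE (v, C). is_endpoint c u1 u2 v C) = (v, C)"
    using ep is_endpoint_unique by (intro the_equality) auto
  have TTSS: "T ** T ** (S ** S) = mat 1"
    by (metis ST matrix_mul_assoc matrix_mul_rid)
  have invA: "matrix_inv A = (q / c\<^sup>2) *\<^sub>R (S ** S)"
    using c q0 TTSS by (intro matrix_inv_eqI)
      (simp add: A_def matrix_mul_scaleR_left matrix_mul_scaleR_right)
  have sqrtA: "inv_sqrt A = (sqrt q / c) *\<^sub>R S"
    using c q0 S by (intro inv_sqrt_eqI)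
      (auto simp: invA matrix_mul_scaleR_left matrix_mul_scaleR_right power2_eq_square
        intro: pos_def_scaleR)
  have SSTT: "S *v (S *v (T *v (T *v x))) = x" for x
    by (metis ST matrix_mul_assoc matrix_vector_mul_assoc matrix_vector_mul_lid)
  have Av: "matrix_inv A *v v = (1 / a) *\<^sub>R b"
    using c q0 a
    by (simp add: invA v_def scaleR_matrix_vector_assoc[symmetric] matrix_vector_mult_scaleR
        matrix_vector_mul_assoc[symmetric] SSTT)
  have "b \<bullet> (T *v (T *v b)) = (norm (T *v b))\<^sup>2"
    using symmetric_inner_swap[OF symT] by (simp add: dot_square_norm)
  then have "v \<bullet> (matrix_inv A *v v) = c\<^sup>2 / (q * a\<^sup>2) * (norm (T *v b))\<^sup>2"
    by (subst Av) (simp add: v_def inner_commute power2_eq_square)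
  \<comment> \<open>The formula for \<open>q00\<close> solved for the norm; it collapses
    \<open>1 + v^T A^-1 v\<close> to \<open>1 / (q a^2)\<close>, whence
    \<open>p = sqrt q a\<close>.\<close>
  moreover have "c\<^sup>2 * (norm (T *v b))\<^sup>2 = 1 - q * a\<^sup>2"
    using a by (simp add: q_def q00_polar T_def)
  ultimately have "1 + v \<bullet> (matrix_inv A *v v) = 1 / (q * a\<^sup>2)"
    using a q0 by (simp add: field_simps)
  then have p: "1 / sqrt (1 + v \<bullet> (matrix_inv A *v v)) = sqrt q * a"
    using a by (simp add: real_sqrt_divide real_sqrt_mult)
  have w3: "w3 c v C = sqrt q *\<^sub>R block a b 0 S"
    unfolding w3_def CA Let_def p unfolding Av sqrtA scaleR_block block_eq_iff
    using a c by simp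
  have rho: "rho c u1 u2 = 1 / sqrt q" by (simp add: rho_def q_def)
  have "w3 c v C ** ((1 / sqrt q) *\<^sub>R block (1 / a) (- (1 / a) *\<^sub>R (b v* T)) 0 T) = mat 1"
    using q0 a ST unfolding w3 matrix_mul_scaleR_left matrix_mul_scaleR_right
    by (simp add: block_mult mat_1_block[where 'n = 'n] block_eq_iff)
  then have w3i: "w3 c v C ** matrix_inv (w3 c v C) = mat 1"
    using matrix_inv_eqI by metis
  have "transport c u1 u2 = (rho c u1 u2 *\<^sub>R block 1 0 0 R) ** w3 c v C"
    using q0 unfolding w3 W rho matrix_mul_scaleR_left matrix_mul_scaleR_right
    by (simp add: block_mult)
  then have "holonomy c u1 u2 = rho c u1 u2 *\<^sub>R block 1 0 0 R ** (w3 c v C ** matrix_inv (w3 c v C))"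
    by (simp add: holonomy_def the matrix_mul_assoc)
  then show hol: "holonomy c u1 u2 = rho c u1 u2 *\<^sub>R block 1 0 0 R"
    by (simp add: w3i)
  have "rho c u1 u2 \<noteq> 0" using q0 rho by simp
  then have "rho c u1 u2 *\<^sub>R block 1 0 0 R = rho c u1 u2 *\<^sub>R block 1 0 0 R' \<longleftrightarrow> R' = R" for R'
    by (auto simp: block_eq_iff)
  then show "holonomy_rotation c u1 u2 = R"
    unfolding holonomy_rotation_def hol by simp
qed

end

section \<open>Matrices acting in a plane\<close>

text \<open>For orthonormal \<open>e1\<close>, \<open>e2\<close> this is the 2 x 2 matrix with rows
  (a, b), (c, d) in their plane and the identity on the orthogonal complement, which makes the
  computation the same in every dimension.\<close>

definition planar :: "real^'n \<Rightarrow> real^'n \<Rightarrow> real \<Rightarrow> real \<Rightarrow> real \<Rightarrow> real \<Rightarrow> real^'n^'n" where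
  "planar e1 e2 a b c d = mat 1 + (a - 1) *\<^sub>R outer e1 e1 + b *\<^sub>R outer e1 e2
     + c *\<^sub>R outer e2 e1 + (d - 1) *\<^sub>R outer e2 e2"

lemma planar_vec:
  "planar e1 e2 a b c d *v x = x + ((a - 1) * (e1 \<bullet> x) + b * (e2 \<bullet> x)) *\<^sub>R e1
     + (c * (e1 \<bullet> x) + (d - 1) * (e2 \<bullet> x)) *\<^sub>R e2"
  by (simp add: planar_def matrix_vector_mult_add_rdistrib outer_mult_vec
      scaleR_matrix_vector_assoc[symmetric] algebra_simps)

lemma transpose_planar: "transpose (planar e1 e2 a b c d) = planar e1 e2 a c b d"
  by (simp add: planar_def transpose_add transpose_scalar transpose_outer)

lemma planar_id: "planar e1 e2 1 0 0 1 = mat 1"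
  by (simp add: planar_def)

lemma planar_plus_outer:
  "planar e1 e2 a b c d + outer (p *\<^sub>R e1 + q *\<^sub>R e2) (r *\<^sub>R e1 + s *\<^sub>R e2)
     = planar e1 e2 (a + p * r) (b + p * s) (c + q * r) (d + q * s)"
  by (simp add: planar_def outer_def vec_eq_iff algebra_simps)

lemma mat_1_plus_outer_planar:
  "mat 1 + k *\<^sub>R outer (p *\<^sub>R e1 + q *\<^sub>R e2) (p *\<^sub>R e1 + q *\<^sub>R e2)
     = planar e1 e2 (1 + k * p\<^sup>2) (k * p * q) (k * p * q) (1 + k * q\<^sup>2)"
  by (simp add: planar_def outer_def vec_eq_iff power2_eq_square algebra_simps)

abbreviation planar_rot :: "real^'n \<Rightarrow> real^'n \<Rightarrow> real \<Rightarrow> real^'n^'n" where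
  "planar_rot e1 e2 \<theta> \<equiv> planar e1 e2 (cos \<theta>) (- sin \<theta>) (sin \<theta>) (cos \<theta>)"

locale orthonormal_pair =
  fixes e1 e2 :: "real^'n::finite"
  assumes e11: "e1 \<bullet> e1 = 1" and e22: "e2 \<bullet> e2 = 1" and e12: "e1 \<bullet> e2 = 0"
begin

lemma e21: "e2 \<bullet> e1 = 0"
  using e12 by (simp add: inner_commute)

lemmas frame_inner = e11 e22 e12 e21 inner_add_left inner_add_right inner_diff_left inner_diff_right
  inner_scaleR_left inner_scaleR_right

lemma planar_mult:
  "planar e1 e2 a b c d ** planar e1 e2 a' b' c' d'
     = planar e1 e2 (a * a' + b * c') (a * b' + b * d') (c * a' + d * c') (c * b' + d * d')"
  unfolding matrix_eq by (simp add: matrix_vector_mul_assoc[symmetric] planar_vec frame_inner algebra_simps)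

lemma planar_vec_frame:
  "planar e1 e2 a b c d *v (x *\<^sub>R e1 + y *\<^sub>R e2) = (a * x + b * y) *\<^sub>R e1 + (c * x + d * y) *\<^sub>R e2"
  by (simp add: planar_vec frame_inner algebra_simps)

lemma frame_norm: "(norm (x *\<^sub>R e1 + y *\<^sub>R e2))\<^sup>2 = x\<^sup>2 + y\<^sup>2"
  by (subst power2_norm_eq_inner) (simp add: frame_inner power2_eq_square)

lemma bessel: "(e1 \<bullet> x)\<^sup>2 + (e2 \<bullet> x)\<^sup>2 \<le> x \<bullet> x"
proof -
  let ?y = "x - (e1 \<bullet> x) *\<^sub>R e1 - (e2 \<bullet> x) *\<^sub>R e2"
  have "?y \<bullet> ?y = x \<bullet> x - ((e1 \<bullet> x)\<^sup>2 + (e2 \<bullet> x)\<^sup>2)"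
    by (simp add: frame_inner power2_eq_square inner_commute[of x e1] inner_commute[of x e2] algebra_simps)
  then show ?thesis using inner_ge_zero[of ?y] by linarith
qed

text \<open>In the plane, \<open>a\<close> times the quadratic form is a completed square plus
  \<open>(a d - b^2) q^2\<close>. Off the plane the operator is the identity, and Bessel's
  inequality makes that contribution nonnegative. The criterion uses the trace because the trace of
  the stretch has a closed form.\<close>

lemma pos_def_planar:
  assumes "0 < a + d" and det: "0 < a * d - b\<^sup>2"
  shows "pos_def (planar e1 e2 a b b d)"
proof -
  have ad: "0 < a * d" using det zero_le_power2[of b] by linarith
  then have a: "0 < a"
    using assms(1) by (auto simp: zero_less_mult_iff)
  have form: "0 < p * (a * p + b * q) + q * (b * p + d * q)" if "p \<noteq> 0 \<or> q \<noteq> 0" for p q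
  proof -
    have "a * (p * (a * p + b * q) + q * (b * p + d * q)) = (a * p + b * q)\<^sup>2 + (a * d - b\<^sup>2) * q\<^sup>2"
      by (simp add: power2_eq_square algebra_simps)
    also have "0 < \<dots>"
    proof (cases "q = 0")
      case True then show ?thesis using that a by simp
    next
      case False then show ?thesis using det by (simp add: add_nonneg_pos)
    qed
    finally show ?thesis using a by (simp add: zero_less_mult_iff)
  qed
  have "0 < x \<bullet> (planar e1 e2 a b b d *v x)" if "x \<noteq> 0" for x
  proof -
    let ?p = "e1 \<bullet> x" and ?q = "e2 \<bullet> x"
    have eq: "x \<bullet> (planar e1 e2 a b b d *v x) = (x \<bullet> x - (?p\<^sup>2 + ?q\<^sup>2))
        + (?p * (a * ?p + b * ?q) + ?q * (b * ?p + d * ?q))"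
      by (simp add: planar_vec inner_add_right inner_commute[of x e1] inner_commute[of x e2] power2_eq_square algebra_simps)
    show ?thesis
    proof (cases "?p = 0 \<and> ?q = 0")
      case True
      then show ?thesis using that by (simp add: eq)
    next
      case False
      then show ?thesis unfolding eq using form[of ?p ?q] bessel[of x] by (simp add: add_nonneg_pos)
    qed
  qed
  then show ?thesis by (simp add: pos_def_def transpose_planar)
qed

lemma planar_rot_mult: "planar_rot e1 e2 x ** planar_rot e1 e2 y = planar_rot e1 e2 (x + y)"
  by (simp add: planar_mult cos_add sin_add algebra_simps)

lemma orthogonal_planar_rot: "orthogonal_matrix (planar_rot e1 e2 \<theta>)"
  unfolding orthogonal_matrix transpose_planar
  using planar_rot_mult[of "-\<theta>" \<theta>] by (simp add: planar_id)

text \<open>The determinant is \<open>1\<close> because the rotation is the square of the rotation by \<open>\<theta>/2\<close>.\<close>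

lemma rotation_planar_rot: "rotation_matrix (planar_rot e1 e2 \<theta>)"
proof -
  have "det (planar_rot e1 e2 \<theta>) = (det (planar_rot e1 e2 (\<theta> / 2)))\<^sup>2"
    using planar_rot_mult[of "\<theta>/2" "\<theta>/2"] by (simp add: power2_eq_square flip: det_mul)
  moreover have "det (planar_rot e1 e2 (\<theta> / 2)) = 1 \<or> det (planar_rot e1 e2 (\<theta> / 2)) = - 1"
    by (rule det_orthogonal_matrix[OF orthogonal_planar_rot])
  ultimately have "det (planar_rot e1 e2 \<theta>) = 1" by auto
  then show ?thesis by (simp add: rotation_matrix_def orthogonal_planar_rot)
qed

end

section \<open>Frames adapted to two steps and the oriented rotation angle\<close>

lemma sin_cos_inj:
  assumes "sin x = sin y" "cos x = cos y" "- pi < x" "x \<le> pi" "- pi < y" "y \<le> pi"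
  shows "x = y"
proof -
  obtain n :: int where n: "x = y + 2 * pi * n"
    using assms(1,2) sin_cos_eq_iff by blast
  have "\<bar>2 * pi * n\<bar> < 2 * pi" using assms(3-) n by linarith
  then have "\<bar>real_of_int n\<bar> < 1" by (simp add: abs_mult)
  then have "n = 0" by linarith
  with n show ?thesis by simp
qed

text \<open>The range of \<phi> makes the \<open>e2\<close> coordinate of \<open>u2\<close>
  nonnegative, the orientation prescribed by \<open>plane_rotation\<close>. Collinear steps are
  included; \<open>e2\<close> is then any unit vector orthogonal to \<open>e1\<close>.\<close>

locale step_frame = orthonormal_pair e1 e2 for e1 e2 :: "real^'n::finite" +
  fixes u1 u2 :: "real^'n" and \<phi> :: real
  assumes u1: "u1 = norm u1 *\<^sub>R e1"
    and u2: "u2 = norm u2 *\<^sub>R (cos \<phi> *\<^sub>R e1 + sin \<phi> *\<^sub>R e2)"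
    and u1_nonzero: "u1 \<noteq> 0" and u2_nonzero: "u2 \<noteq> 0"
    and phi: "0 \<le> \<phi>" "\<phi> \<le> pi"
begin

lemma sin_phi_nonneg: "0 \<le> sin \<phi>"
  using phi by (simp add: sin_ge_zero)

lemma plane_rotation_frame: "plane_rotation u1 u2 (planar_rot e1 e2 \<theta>) \<theta>"
proof -
  have "u2 = (norm u2 * cos \<phi>) *\<^sub>R e1 + (norm u2 * sin \<phi>) *\<^sub>R e2"
    using u2 by (simp add: algebra_simps)
  moreover have "0 \<le> norm u2 * sin \<phi>" using sin_phi_nonneg by simp
  ultimately have half: "\<exists>a b. 0 \<le> b \<and> u2 = a *\<^sub>R e1 + b *\<^sub>R e2" by blast
  have perp: "planar_rot e1 e2 \<theta> *v x = x" if "x \<bullet> e1 = 0 \<and> x \<bullet> e2 = 0" for x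
    using that by (simp add: planar_vec inner_commute)
  have "planar_rot e1 e2 \<theta> *v e1 = cos \<theta> *\<^sub>R e1 + sin \<theta> *\<^sub>R e2"
    "planar_rot e1 e2 \<theta> *v e2 = - sin \<theta> *\<^sub>R e1 + cos \<theta> *\<^sub>R e2"
    by (simp_all add: planar_vec frame_inner algebra_simps)
  then show ?thesis
    unfolding plane_rotation_def using half perp u1 e11 e22 e12
    by (intro exI[of _ e1] exI[of _ e2]) (auto simp: norm_eq_1)
qed

text \<open>For collinear steps the plane is not determined, but the identity has angle \<open>0\<close> in every plane.\<close>

lemma rotation_angle_frame:
  assumes "- pi < \<theta>" "\<theta> \<le> pi" and deg: "sin \<phi> = 0 \<Longrightarrow> \<theta> = 0"
  shows "rotation_angle u1 u2 (planar_rot e1 e2 \<theta>) = \<theta>"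
  unfolding rotation_angle_def
proof (rule the_equality)
  show "- pi < \<theta> \<and> \<theta> \<le> pi \<and> plane_rotation u1 u2 (planar_rot e1 e2 \<theta>) \<theta>"
    using assms plane_rotation_frame by blast
next
  fix t assume t: "- pi < t \<and> t \<le> pi \<and> plane_rotation u1 u2 (planar_rot e1 e2 \<theta>) t"
  then obtain f1 f2 a b where f: "norm f1 = 1" "norm f2 = 1" "f1 \<bullet> f2 = 0" "u1 = norm u1 *\<^sub>R f1"
      "0 \<le> b" "u2 = a *\<^sub>R f1 + b *\<^sub>R f2"
      "planar_rot e1 e2 \<theta> *v f1 = cos t *\<^sub>R f1 + sin t *\<^sub>R f2"
    unfolding plane_rotation_def by blast
  have f1: "f1 = e1"
    using u1 f(4) u1_nonzero by (metis scaleR_cancel_left norm_eq_zero)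
  have "sin t = f2 \<bullet> (planar_rot e1 e2 \<theta> *v f1)" "cos t = f1 \<bullet> (planar_rot e1 e2 \<theta> *v f1)"
    unfolding f(7) using f(1-3) by (simp_all add: inner_add_right norm_eq_1 inner_commute)
  \<comment> \<open>A competing frame shares \<open>e1\<close>, so the cosine is settled, and the
    sine up to the factor \<open>f2 \<bullet> e2\<close>. That factor is 1 when \<open>u2\<close> is
    off the line of \<open>u1\<close>, and multiplies sin \<theta> = 0 in the collinear
    case.\<close>
  then have t_eq: "sin t = sin \<theta> * (f2 \<bullet> e2)" "cos t = cos \<theta>"
    using f(3) unfolding f1 by (simp_all add: planar_vec frame_inner inner_commute)
  show "t = \<theta>"
  proof (cases "sin \<phi> = 0")
    case True
    then show ?thesis using deg t_eq t sin_cos_inj[of t 0] by auto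
  next
    case False
    with sin_phi_nonneg u2_nonzero have pos: "0 < norm u2 * sin \<phi>" by simp
    have "e1 \<bullet> u2 = a" using f(1,3,6) f1 by (simp add: inner_add_right norm_eq_1)
    moreover have "e1 \<bullet> u2 = norm u2 * cos \<phi>" by (subst u2) (simp add: frame_inner)
    ultimately have "b *\<^sub>R f2 = (norm u2 * sin \<phi>) *\<^sub>R e2"
      using u2 f(6) f1 by (simp add: algebra_simps)
    moreover from this have "b = norm u2 * sin \<phi>"
      using f(2,5) pos e22 by (metis norm_scaleR abs_of_nonneg less_imp_le mult.right_neutral norm_eq_1)
    ultimately have "f2 = e2" using False u2_nonzero by simp
    then show ?thesis using t_eq e22 t assms sin_cos_inj[of t \<theta>] by auto
  qed
qed

lemma sgn_u1: "sgn u1 = e1"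
proof -
  have "sgn u1 = sgn (norm u1 *\<^sub>R e1)" using u1 by simp
  then show ?thesis
    using u1_nonzero by (simp only: sgn_scaleR) (simp add: sgn_div_norm e11 norm_eq_sqrt_inner)
qed

lemma sgn_u2: "sgn u2 = cos \<phi> *\<^sub>R e1 + sin \<phi> *\<^sub>R e2"
proof -
  have "norm (cos \<phi> *\<^sub>R e1 + sin \<phi> *\<^sub>R e2) = 1"
    by (simp add: norm_eq_1 frame_inner flip: power2_eq_square)
  moreover have "sgn u2 = sgn (norm u2 *\<^sub>R (cos \<phi> *\<^sub>R e1 + sin \<phi> *\<^sub>R e2))" using u2 by simp
  ultimately show ?thesis
    using u2_nonzero by (simp only: sgn_scaleR) (simp add: sgn_div_norm)
qed

end

lemma unit_orthogonal_exists:
  fixes e :: "real^'n"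
  assumes "2 \<le> CARD('n)"
  obtains f where "norm f = 1" "e \<bullet> f = 0"
proof -
  obtain y where "y \<noteq> 0" "orthogonal e y"
    using orthogonal_to_vector_exists[of e] assms by auto
  then show thesis
    using that[of "sgn y"] by (simp add: norm_sgn orthogonal_def sgn_div_norm)
qed

lemma angle_between_cos:
  fixes u1 u2 :: "real^'n"
  shows "cos (angle_between u1 u2) = (u1 \<bullet> u2) / (norm u1 * norm u2)"
    "0 \<le> angle_between u1 u2" "angle_between u1 u2 \<le> pi"
proof -
  have "\<bar>(u1 \<bullet> u2) / (norm u1 * norm u2)\<bar> \<le> 1"
    using Cauchy_Schwarz_ineq2[of u1 u2] by (auto simp: divide_le_eq)
  then have "- 1 \<le> (u1 \<bullet> u2) / (norm u1 * norm u2)" "(u1 \<bullet> u2) / (norm u1 * norm u2) \<le> 1"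
    by (simp_all only: abs_le_iff) linarith
  then show "cos (angle_between u1 u2) = (u1 \<bullet> u2) / (norm u1 * norm u2)"
    "0 \<le> angle_between u1 u2" "angle_between u1 u2 \<le> pi"
    unfolding angle_between_def by (simp_all add: arccos_lbound arccos_ubound)
qed

text \<open>Gram-Schmidt: the residual \<open>r\<close> has norm exactly sin \<phi>, so normalising
  it gives the required orientation. If it vanishes, dimension at least 2 supplies an orthogonal
  unit vector.\<close>

lemma step_frame_exists:
  fixes u1 u2 :: "real^'n"
  assumes d: "2 \<le> CARD('n)" and nz: "u1 \<noteq> 0" "u2 \<noteq> 0"
  obtains e1 e2 where "step_frame e1 e2 u1 u2 (angle_between u1 u2)"
proof -
  define \<phi> e1 n2 where "\<phi> = angle_between u1 u2" and "e1 = sgn u1" and "n2 = sgn u2"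
  have unit: "e1 \<bullet> e1 = 1" "n2 \<bullet> n2 = 1"
    using nz by (simp_all add: e1_def n2_def norm_sgn flip: norm_eq_1)
  have cos: "e1 \<bullet> n2 = cos \<phi>"
    using nz by (simp add: e1_def n2_def \<phi>_def angle_between_cos sgn_div_norm field_simps)
  have phi: "0 \<le> \<phi>" "\<phi> \<le> pi" by (simp_all add: \<phi>_def angle_between_cos)
  define r where "r = n2 - cos \<phi> *\<^sub>R e1"
  have r1: "e1 \<bullet> r = 0" by (simp add: r_def inner_diff_right unit cos)
  have "r \<bullet> r = 1 - (cos \<phi>)\<^sup>2"
    by (simp add: r_def inner_diff_right inner_diff_left unit cos inner_commute[of n2 e1] power2_eq_square)
  then have "(norm r)\<^sup>2 = (sin \<phi>)\<^sup>2" by (simp add: power2_norm_eq_inner sin_squared_eq)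
  then have nr: "norm r = sin \<phi>"
    using phi by (simp add: sin_ge_zero)
  obtain e2 where e2: "norm e2 = 1" "e1 \<bullet> e2 = 0" "r = sin \<phi> *\<^sub>R e2"
  proof (cases "r = 0")
    case True
    obtain f where "norm f = 1" "e1 \<bullet> f = 0"
      using unit_orthogonal_exists[OF d] by blast
    with True nr show ?thesis by (intro that[of f]) simp_all
  next
    case False
    with nr have "sin \<phi> \<noteq> 0" by auto
    with False show ?thesis
      using r1 nr that[of "sgn r"] norm_sgn[of r] by (simp add: sgn_div_norm)
  qed
  have "u1 = norm u1 *\<^sub>R e1" "u2 = norm u2 *\<^sub>R n2"
    using nz by (simp_all add: e1_def n2_def sgn_div_norm)
  moreover have "n2 = cos \<phi> *\<^sub>R e1 + sin \<phi> *\<^sub>R e2"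
    by (simp add: e2(3)[symmetric] r_def)
  ultimately have "step_frame e1 e2 u1 u2 \<phi>"
    using unit(1) e2(1,2) nz phi by unfold_locales (simp_all add: norm_eq_1)
  then show thesis using that \<phi>_def by blast
qed

section \<open>The holonomy of two boost steps\<close>

lemma galilei_block: "galilei v = block 1 0 (- v) (mat 1)"
  by (auto simp: vec_eq_iff galilei_def matrix_def event_def time_of_def space_of_def block_def
      axis_def mat_def split: option.splits)

lemma inner_axis_space: "v \<bullet> (\<chi> j. axis (Some l) 1 $ Some j) = v $ l"
proof -
  have "(\<chi> j. axis (Some l) 1 $ Some j) = axis l (1::real)"
    by (simp add: axis_def vec_eq_iff)
  then show ?thesis by (simp add: inner_axis)
qed

lemma inner_axis_time: "v \<bullet> (\<chi> j. axis None 1 $ Some j) = 0"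
  by (simp add: inner_vec_def axis_def)

lemma lorentz_boost_block:
  "lorentz_boost c v = block (lorentz_factor c v) (- (lorentz_factor c v / c\<^sup>2) *\<^sub>R v)
     (- lorentz_factor c v *\<^sub>R v) (mat 1 + (lorentz_factor c v - 1) *\<^sub>R outer (sgn v) (sgn v))"
  by (auto simp: vec_eq_iff lorentz_boost_def matrix_def event_def time_of_def space_of_def block_def
      inner_axis_space inner_axis_time Let_def outer_def split: option.splits)
    (auto simp: axis_def mat_def)

lemma lorentz_factor_minus: "lorentz_factor c (- v) = lorentz_factor c v"
  by (simp add: lorentz_factor_def)

lemma speed_ratio:
  assumes "0 < c" "norm v < c"
  shows "0 \<le> (norm v)\<^sup>2 / c\<^sup>2" "(norm v)\<^sup>2 / c\<^sup>2 < 1"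
  using assms by (simp_all add: power_strict_mono)

lemma lorentz_factor_square:
  assumes "0 < c" "norm v < c"
  shows "(lorentz_factor c v)\<^sup>2 * (1 - (norm v)\<^sup>2 / c\<^sup>2) = 1"
proof -
  have "(norm v)\<^sup>2 < c\<^sup>2" using assms by (intro power_strict_mono) auto
  then show ?thesis
    using speed_ratio[OF assms] by (simp add: lorentz_factor_def power_divide)
qed

lemma lorentz_factor_ge_1:
  assumes "0 < c" "norm v < c"
  shows "1 \<le> lorentz_factor c v"
  using speed_ratio[OF assms] by (simp add: lorentz_factor_def)

lemma lorentz_factor_gt_1:
  assumes "0 < c" "norm v < c" "v \<noteq> 0"
  shows "1 < lorentz_factor c v"
  using speed_ratio[OF assms(1,2)] assms by (simp add: lorentz_factor_def)

lemma sgn_inner_self: "sgn v \<bullet> v = norm v" for v :: "real^'n"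
  by (cases "v = 0") (simp_all add: sgn_div_norm dot_square_norm power2_eq_square)

text \<open>The stretch multiplies its own direction by \<gamma>, so the Galilei column
  \<open>- B v\<close> cancels the column \<open>\<gamma> v\<close> of the inverse boost. The time
  entry is \<open>\<gamma> (1 - v^2/c^2) = 1/\<gamma>\<close>.\<close>

lemma w_step_block:
  assumes "0 < c" "norm v < c"
  shows "w_step c v = block (1 / lorentz_factor c v) ((lorentz_factor c v / c\<^sup>2) *\<^sub>R v) 0
     (mat 1 + (lorentz_factor c v - 1) *\<^sub>R outer (sgn v) (sgn v))"
proof -
  let ?g = "lorentz_factor c v"
  have "0 < ?g" using lorentz_factor_ge_1[OF assms] by simp
  moreover have "?g * ?g * (1 - (v \<bullet> v) / c\<^sup>2) = 1"
    using lorentz_factor_square[OF assms] by (simp add: power2_eq_square dot_square_norm)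
  ultimately have t: "?g - ?g / c\<^sup>2 * (v \<bullet> v) = 1 / ?g"
    by (simp add: field_simps)
  have B: "(mat 1 + (?g - 1) *\<^sub>R outer (sgn v) (sgn v)) *v v = ?g *\<^sub>R v"
    by (simp add: matrix_vector_mult_add_rdistrib scaleR_matrix_vector_assoc[symmetric] outer_mult_vec
        sgn_inner_self) (cases "v = 0"; simp add: sgn_div_norm algebra_simps)
  let ?B = "mat 1 + (?g - 1) *\<^sub>R outer (sgn v) (sgn v)"
  have "lorentz_boost c (- v) = block ?g ((?g / c\<^sup>2) *\<^sub>R v) (?g *\<^sub>R v) ?B"
    by (simp add: lorentz_boost_block lorentz_factor_minus sgn_minus outer_def vec_eq_iff block_def)
  then show ?thesis
    using t B by (simp add: w_step_def galilei_block block_mult block_eq_iff matrix_vector_mult_minus)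
qed

section \<open>Polar decomposition of the product of two stretches\<close>

definition holonomy_tan :: "real \<Rightarrow> real \<Rightarrow> real \<Rightarrow> real" where
  "holonomy_tan k1 k2 \<phi> = k1 * k2 * cos \<phi> * sin \<phi> / (2 + k1 + k2 + k1 * k2 * (cos \<phi>)\<^sup>2)"

text \<open>The excesses \<open>k1\<close>, \<open>k2\<close> are parameters, so that pairs with
  equal speeds but different angles can share them.\<close>

locale boost_pair = step_frame e1 e2 u1 u2 \<phi> for e1 e2 u1 u2 :: "real^'n::finite" and \<phi> +
  fixes c k1 k2 :: real
  assumes c: "0 < c" and u1_less: "norm u1 < c" and u2_less: "norm u2 < c"
    and k1: "lorentz_factor c u1 = 1 + k1" and k2: "lorentz_factor c u2 = 1 + k2"
begin

lemma k_pos: "0 < k1" "0 < k2"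
  using lorentz_factor_gt_1[OF c u1_less u1_nonzero] lorentz_factor_gt_1[OF c u2_less u2_nonzero]
  by (simp_all add: k1 k2)

text \<open>In the frame, the spatial blocks of the two steps are \<open>diag (1 + k1, 1)\<close> and
  \<open>((P, Q), (Q, Z))\<close>. For the product \<open>M\<close> of the second with the first, \<open>D\<close> is the trace and \<open>N\<close> the
  skew part \<open>M 2 1 - M 1 2\<close>, so the rotation making \<open>R\<^sup>T M\<close> symmetric has tangent \<open>N / D\<close>.\<close>

definition P where "P = 1 + k2 * (cos \<phi>)\<^sup>2"
definition Q where "Q = k2 * cos \<phi> * sin \<phi>"
definition Z where "Z = 1 + k2 * (sin \<phi>)\<^sup>2"

lemma det_PQZ: "P * Z - Q\<^sup>2 = 1 + k2"
proof -
  have "P * Z - Q\<^sup>2 = 1 + (k2 * (cos \<phi>)\<^sup>2 + k2 * (sin \<phi>)\<^sup>2)"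
    by (simp add: P_def Q_def Z_def power2_eq_square algebra_simps)
  then show ?thesis by (simp flip: distrib_left)
qed

lemma stretch1: "mat 1 + k1 *\<^sub>R outer (sgn u1) (sgn u1) = planar e1 e2 (1 + k1) 0 0 1"
  using mat_1_plus_outer_planar[of k1 1 e1 0 e2] by (simp add: sgn_u1)

lemma stretch2: "mat 1 + k2 *\<^sub>R outer (sgn u2) (sgn u2) = planar e1 e2 P Q Q Z"
  using mat_1_plus_outer_planar[of k2 "cos \<phi>" e1 "sin \<phi>" e2] by (simp add: sgn_u2 P_def Q_def Z_def)

definition time_row where
  "time_row = ((1 + k1) / ((1 + k2) * c\<^sup>2)) *\<^sub>R u1 + ((1 + k2) / c\<^sup>2) *\<^sub>R (planar e1 e2 (1 + k1) 0 0 1 *v u2)"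

lemma transport_block:
  "transport c u1 u2 = block (1 / ((1 + k1) * (1 + k2))) time_row 0
     (planar e1 e2 P Q Q Z ** planar e1 e2 (1 + k1) 0 0 1)"
proof -
  have "u2 v* planar e1 e2 (1 + k1) 0 0 1 = planar e1 e2 (1 + k1) 0 0 1 *v u2"
    by (rule symmetric_vec_mult) (simp add: transpose_planar)
  then show ?thesis
    unfolding transport_def w_step_block[OF c u1_less] w_step_block[OF c u2_less] k1 k2
    by (simp add: stretch1 stretch2 block_mult time_row_def scaleR_vector_matrix_assoc block_eq_iff)
qed

definition N where "N = k1 * k2 * cos \<phi> * sin \<phi>"
definition D where "D = 2 + k1 + k2 + k1 * k2 * (cos \<phi>)\<^sup>2"
definition r where "r = sqrt (D\<^sup>2 + N\<^sup>2)"

definition angle where "angle = arctan (holonomy_tan k1 k2 \<phi>)"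

lemma D_pos: "0 < D"
  unfolding D_def using k_pos by (intro add_pos_nonneg) auto

lemma r_pos: "0 < r"
  unfolding r_def using D_pos by (simp add: add_pos_nonneg)

lemma r_square: "r * r = D * D + N * N"
  unfolding r_def by (simp add: power2_eq_square)

lemma cos_sin_angle: "cos angle = D / r" "sin angle = N / r"
proof -
  have t: "holonomy_tan k1 k2 \<phi> = N / D" by (simp add: holonomy_tan_def N_def D_def)
  have "sqrt (1 + (N / D)\<^sup>2) = r / D"
    using D_pos by (simp add: r_def field_simps real_sqrt_divide)
  then show "cos angle = D / r" "sin angle = N / r"
    using D_pos r_pos by (simp_all add: angle_def t cos_arctan sin_arctan)
qed

text \<open>This is \<open>R^T M\<close>, where \<open>R\<close> has cosine \<open>D / r\<close> and
  sine \<open>N / r\<close>. The lower left entry is written as the upper right one, which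
  \<open>polar_symmetric\<close> justifies.\<close>

definition stretch where
  "stretch = planar e1 e2 ((D * (P * (1 + k1)) + N * (Q * (1 + k1))) / r) ((D * Q + N * Z) / r)
     ((D * Q + N * Z) / r) ((D * Z - N * Q) / r)"

lemma trace_PZ: "P * (1 + k1) + Z = D" and skew_Q: "Q * (1 + k1) - Q = N"
proof -
  have "P * (1 + k1) + Z = 2 + k1 + k1 * k2 * (cos \<phi>)\<^sup>2 + (k2 * (cos \<phi>)\<^sup>2 + k2 * (sin \<phi>)\<^sup>2)"
    by (simp add: P_def Z_def algebra_simps)
  then show "P * (1 + k1) + Z = D" by (simp add: D_def flip: distrib_left)
  show "Q * (1 + k1) - Q = N" by (simp add: Q_def N_def algebra_simps)
qed

text \<open>The off-diagonal entries of \<open>r R^T M\<close> differ by \<open>N\<close> times the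
  trace of \<open>M\<close> minus \<open>D\<close> times its skew part, that is by
  \<open>N D - D N\<close>. This condition is what determines the angle.\<close>

lemma polar_symmetric: "D * Q + N * Z = D * (Q * (1 + k1)) - N * (P * (1 + k1))"
proof -
  have "D * (Q * (1 + k1) - Q) = N * (P * (1 + k1) + Z)" by (simp add: trace_PZ skew_Q)
  then show ?thesis by (simp add: algebra_simps)
qed

lemma polar_decomposition:
  "planar e1 e2 P Q Q Z ** planar e1 e2 (1 + k1) 0 0 1 = planar_rot e1 e2 angle ** stretch"
proof -
  have mult: "planar_rot e1 e2 angle ** planar e1 e2 ((D * a + N * d) / r) ((D * b + N * e) / r)
      ((D * d - N * a) / r) ((D * e - N * b) / r) = planar e1 e2 a b d e" for a b d e
  proof -
    have "D * (D * x + N * y) - N * (D * y - N * x) = r * r * x"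
      "N * (D * x + N * y) + D * (D * y - N * x) = r * r * y" for x y
      by (simp_all add: r_square algebra_simps)
    then show ?thesis
      unfolding planar_mult cos_sin_angle using r_pos by (simp flip: add_divide_distrib diff_divide_distrib)
  qed
  have "stretch = planar e1 e2 ((D * (P * (1 + k1)) + N * (Q * (1 + k1))) / r) ((D * Q + N * Z) / r)
     ((D * (Q * (1 + k1)) - N * (P * (1 + k1))) / r) ((D * Z - N * Q) / r)"
    unfolding stretch_def by (simp only: polar_symmetric)
  then show ?thesis by (simp only: mult) (simp add: planar_mult)
qed

text \<open>The trace is \<open>(D^2 + N^2) / r = r\<close>, and the determinant is that of
  \<open>M\<close>, namely \<open>(1 + k1) (1 + k2)\<close>, since a rotation preserves it.\<close>

lemma pos_def_stretch: "pos_def stretch"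
  unfolding stretch_def
proof (rule pos_def_planar)
  have "(D * (P * (1 + k1)) + N * (Q * (1 + k1))) + (D * Z - N * Q) = D * (P * (1 + k1) + Z) + N * (Q * (1 + k1) - Q)"
    by (simp add: algebra_simps)
  also have "\<dots> = r * r" by (simp add: trace_PZ skew_Q r_square)
  finally show "0 < (D * (P * (1 + k1)) + N * (Q * (1 + k1))) / r + (D * Z - N * Q) / r"
    using r_pos by (simp flip: add_divide_distrib)
  \<comment> \<open>Writing one of the two equal off-diagonal factors in its other form restores the
    entries of \<open>r R^T M\<close>, whose determinant factors identically.\<close>
  have "(D * (P * (1 + k1)) + N * (Q * (1 + k1))) * (D * Z - N * Q) - (D * Q + N * Z) * (D * Q + N * Z)
      = (D * (P * (1 + k1)) + N * (Q * (1 + k1))) * (D * Z - N * Q)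
        - (D * Q + N * Z) * (D * (Q * (1 + k1)) - N * (P * (1 + k1)))"
    by (simp only: polar_symmetric)
  also have "\<dots> = (D * D + N * N) * ((P * Z - Q\<^sup>2) * (1 + k1))"
    by (simp add: power2_eq_square algebra_simps)
  finally have "(D * (P * (1 + k1)) + N * (Q * (1 + k1))) * (D * Z - N * Q) - (D * Q + N * Z)\<^sup>2
      = r * r * ((1 + k2) * (1 + k1))"
    unfolding det_PQZ r_square by (simp add: power2_eq_square)
  then have "(D * (P * (1 + k1)) + N * (Q * (1 + k1))) / r * ((D * Z - N * Q) / r) - ((D * Q + N * Z) / r)\<^sup>2
      = (1 + k2) * (1 + k1)"
    using r_pos by (simp add: field_simps power2_eq_square)
  then show "0 < (D * (P * (1 + k1)) + N * (Q * (1 + k1))) / r * ((D * Z - N * Q) / r) - ((D * Q + N * Z) / r)\<^sup>2"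
    using k_pos by simp
qed

lemma transport_polar:
  "transport c u1 u2 = block (1 / ((1 + k1) * (1 + k2))) time_row 0 (planar_rot e1 e2 angle ** stretch)"
  by (simp add: transport_block polar_decomposition)

lemma angle_bounds: "- pi < angle" "angle \<le> pi"
  using arctan_bounded[of "holonomy_tan k1 k2 \<phi>"] pi_gt_zero unfolding angle_def by linarith+

lemma holonomy_boost_pair:
  assumes "0 < q00 c u1 u2"
  shows "admissible_endpoint c u1 u2"
    and "holonomy c u1 u2 = rho c u1 u2 *\<^sub>R block 1 0 0 (planar_rot e1 e2 angle)"
    and "holonomy_rotation c u1 u2 = planar_rot e1 e2 angle"
    and "holonomy_angle c u1 u2 = angle"
proof -
  have a: "0 < 1 / ((1 + k1) * (1 + k2))" using k_pos by simp
  note polar = endpoint_polar[OF c a pos_def_stretch orthogonal_planar_rot transport_polar assms]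
  show "admissible_endpoint c u1 u2"
    and "holonomy c u1 u2 = rho c u1 u2 *\<^sub>R block 1 0 0 (planar_rot e1 e2 angle)"
    and R: "holonomy_rotation c u1 u2 = planar_rot e1 e2 angle"
    by (fact polar)+
  show "holonomy_angle c u1 u2 = angle"
    unfolding holonomy_angle_def R
    by (rule rotation_angle_frame[OF angle_bounds]) (simp add: angle_def holonomy_tan_def)
qed

text \<open>Each spatial block stretches one direction by \<gamma> \<ge> 1 and shortens no vector;
  the rotation in the polar decomposition preserves norms. Hence the inverse of
  \<open>stretch\<close> is a contraction.\<close>

lemma norm_stretch_ge: "norm x \<le> norm (stretch *v x)"
proof -
  have expand: "norm x \<le> norm ((mat 1 + k *\<^sub>R outer n n) *v x)" if "0 \<le> k" "n \<bullet> n = 1" for k n x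
  proof -
    have "(norm ((mat 1 + k *\<^sub>R outer n n) *v x))\<^sup>2 = (norm x)\<^sup>2 + (2 * k + k\<^sup>2) * (n \<bullet> x)\<^sup>2"
      using that(2) unfolding power2_norm_eq_inner
      by (simp add: matrix_vector_mult_add_rdistrib scaleR_matrix_vector_assoc[symmetric] outer_mult_vec
        inner_add_left inner_add_right inner_commute[of x n] power2_eq_square algebra_simps)
    then have "(norm x)\<^sup>2 \<le> (norm ((mat 1 + k *\<^sub>R outer n n) *v x))\<^sup>2" using that(1) by simp
    then show ?thesis by (rule power2_le_imp_le) simp
  qed
  have n: "sgn u1 \<bullet> sgn u1 = 1" "sgn u2 \<bullet> sgn u2 = 1"
    using u1_nonzero u2_nonzero by (simp_all add: norm_sgn flip: norm_eq_1)
  have "norm x \<le> norm (planar e1 e2 (1 + k1) 0 0 1 *v x)"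
    unfolding stretch1[symmetric] using k_pos n by (intro expand) auto
  also have "\<dots> \<le> norm (planar e1 e2 P Q Q Z *v (planar e1 e2 (1 + k1) 0 0 1 *v x))"
    unfolding stretch2[symmetric] using k_pos n by (intro expand) auto
  also have "\<dots> = norm (planar_rot e1 e2 angle *v (stretch *v x))"
    by (simp add: matrix_vector_mul_assoc polar_decomposition)
  also have "\<dots> = norm (stretch *v x)"
    using orthogonal_planar_rot
    by (metis orthogonal_transformation_matrix matrix_of_matrix_vector_mul matrix_vector_mul_linear
        orthogonal_transformation_norm)
  finally show ?thesis .
qed

text \<open>Up to a positive factor \<open>q00\<close> is \<open>1 - c^2 |S^-1 b|^2\<close>, and
  \<open>S^-1\<close> is a contraction, so it is enough to estimate the time row itself.\<close>

lemma q00_pos: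
  assumes small: "c * norm time_row < 1"
  shows "0 < q00 c u1 u2"
proof -
  have a: "0 < 1 / ((1 + k1) * (1 + k2))" using k_pos by simp
  let ?x = "matrix_inv stretch *v time_row"
  have "stretch *v ?x = time_row"
    by (simp add: matrix_vector_mul_assoc pos_def_mult_inv[OF pos_def_stretch])
  then have "norm ?x \<le> norm time_row" using norm_stretch_ge[of ?x] by simp
  then have "c * norm ?x < 1" using small c by (smt (verit) mult_left_mono)
  then have "(c * norm ?x)\<^sup>2 < 1" using c by (simp add: power_less_one_iff abs_square_less_1)
  then have "0 < 1 - c\<^sup>2 * (norm ?x)\<^sup>2" by (simp add: power_mult_distrib)
  then show ?thesis
    unfolding q00_polar[OF c a pos_def_stretch orthogonal_planar_rot transport_polar]
    using k_pos by (intro divide_pos_pos) auto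
qed

end

section \<open>The Thomas--Wigner rotation\<close>

lemma pos_def_mat_1_plus_outer:
  assumes "0 \<le> k"
  shows "pos_def (mat 1 + k *\<^sub>R outer n n)"
proof -
  have "0 < x \<bullet> ((mat 1 + k *\<^sub>R outer n n) *v x)" if "x \<noteq> 0" for x
  proof -
    have "x \<bullet> ((mat 1 + k *\<^sub>R outer n n) *v x) = x \<bullet> x + k * (n \<bullet> x)\<^sup>2"
      by (simp add: matrix_vector_mult_add_rdistrib scaleR_matrix_vector_assoc[symmetric] outer_mult_vec
        inner_add_right inner_commute[of x n] power2_eq_square)
    then show ?thesis using that assms by (simp add: add_pos_nonneg)
  qed
  then show ?thesis
    by (simp add: pos_def_def transpose_add transpose_scalar transpose_outer)
qed

text \<open>The boost of rapidity \<eta> in double-argument form: with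
  \<open>|h| = sinh (\<eta>/2)\<close>, \<open>1 + 2 |h|^2 = cosh \<eta>\<close> and
  \<open>2 sqrt (1 + |h|^2) |h| = sinh \<eta>\<close>.\<close>

definition half_boost :: "real \<Rightarrow> real^'n \<Rightarrow> real^('n::finite) option^('n::finite) option" where
  "half_boost c h = block (1 + 2 * (h \<bullet> h)) (- (2 * sqrt (1 + h \<bullet> h) / c) *\<^sub>R h)
     (- (2 * sqrt (1 + h \<bullet> h) * c) *\<^sub>R h) (mat 1 + 2 *\<^sub>R outer h h)"

text \<open>With rapidity \<open>\<eta>\<close>, the half vector is \<open>sinh (\<eta>/2)\<close> times the direction of the boost; in it
  the composition law is that of spinors, i.e. polynomial up to normalization.\<close>

definition half_sinh :: "real \<Rightarrow> real^'n \<Rightarrow> real" where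
  "half_sinh c v = sqrt ((lorentz_factor c v - 1) / 2)"

lemma half_sinh_square:
  assumes "0 < c" "norm v < c"
  shows "(half_sinh c v)\<^sup>2 = (lorentz_factor c v - 1) / 2"
  using lorentz_factor_ge_1[OF assms] by (simp add: half_sinh_def)

lemma half_sinh_cosh:
  assumes "0 < c" "norm v < c"
  shows "2 * sqrt (1 + (half_sinh c v)\<^sup>2) * half_sinh c v = lorentz_factor c v * norm v / c"
proof (rule power2_eq_imp_eq)
  let ?g = "lorentz_factor c v"
  note g = lorentz_factor_ge_1[OF assms]
  have "(2 * sqrt (1 + (half_sinh c v)\<^sup>2) * half_sinh c v)\<^sup>2
      = 4 * (1 + (half_sinh c v)\<^sup>2) * (half_sinh c v)\<^sup>2"
    by (simp add: power_mult_distrib)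
  also have "\<dots> = ?g\<^sup>2 - 1"
    unfolding half_sinh_square[OF assms] by (simp add: field_simps power2_eq_square)
  also have "\<dots> = (?g * norm v / c)\<^sup>2"
    using lorentz_factor_square[OF assms] by (simp add: field_simps)
  finally show "(2 * sqrt (1 + (half_sinh c v)\<^sup>2) * half_sinh c v)\<^sup>2 = (?g * norm v / c)\<^sup>2" .
qed (use assms lorentz_factor_ge_1[OF assms] in \<open>simp_all add: half_sinh_def\<close>)

lemma lorentz_boost_half:
  assumes "0 < c" "norm v < c"
  shows "lorentz_boost c v = half_boost c (half_sinh c v *\<^sub>R sgn v)"
proof (cases "v = 0")
  case True
  then show ?thesis by (simp add: lorentz_boost_block half_boost_def lorentz_factor_def)
next
  case False
  define s E where "s = half_sinh c v" and "E = sqrt (1 + s\<^sup>2)"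
  let ?g = "lorentz_factor c v"
  have hh: "(s *\<^sub>R sgn v) \<bullet> (s *\<^sub>R sgn v) = s\<^sup>2"
    using False by (simp add: power2_eq_square norm_sgn flip: norm_eq_1)
  have s2: "1 + 2 * s\<^sup>2 = ?g" unfolding s_def half_sinh_square[OF assms] by (simp add: field_simps)
  have "(2 * E * s) *\<^sub>R sgn v = (?g / c) *\<^sub>R v"
    using half_sinh_cosh[OF assms] False by (simp add: s_def E_def sgn_div_norm)
  then have v: "(2 * E) *\<^sub>R (s *\<^sub>R sgn v) = (?g / c) *\<^sub>R v" by simp
  have v1: "(2 * E / c) *\<^sub>R (s *\<^sub>R sgn v) = (?g / c\<^sup>2) *\<^sub>R v"
    using arg_cong[OF v, of "\<lambda>x. (1 / c) *\<^sub>R x"] by (simp add: power2_eq_square)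
  have v2: "(2 * E * c) *\<^sub>R (s *\<^sub>R sgn v) = ?g *\<^sub>R v"
    using arg_cong[OF v, of "\<lambda>x. c *\<^sub>R x"] assms by (simp add: ac_simps)
  have B: "2 *\<^sub>R outer (s *\<^sub>R sgn v) (s *\<^sub>R sgn v) = (?g - 1) *\<^sub>R outer (sgn v) (sgn v)"
    by (simp add: outer_scaleR_left outer_scaleR_right s2[symmetric] power2_eq_square)
  show ?thesis
    unfolding lorentz_boost_block half_boost_def s_def[symmetric] hh E_def[symmetric] s2 B
      scaleR_minus_left v1 v2 ..
qed

lemma half_boost_lorentz:
  assumes c: "0 < c"
  obtains w where "norm w < c" "lorentz_boost c w = half_boost c h"
proof (cases "h = 0")
  case True
  then show ?thesis
    using that[of 0] lorentz_boost_half[OF c, of 0] c by simp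
next
  case False
  define m where "m = h \<bullet> h"
  have m: "0 < m" using False by (simp add: m_def)
  \<comment> \<open>The speed is \<open>c tanh \<eta>\<close>, with
    \<open>cosh \<eta> = 1 + 2 m\<close> and
    \<open>sinh \<eta> = 2 sqrt (1 + m) |h|\<close>.\<close>
  define w where "w = (2 * c * sqrt (1 + m) / (1 + 2 * m)) *\<^sub>R h"
  have "(norm w)\<^sup>2 = (2 * c * sqrt (1 + m) / (1 + 2 * m))\<^sup>2 * m"
    by (simp only: w_def norm_scaleR power_mult_distrib power2_abs m_def power2_norm_eq_inner)
  also have "\<dots> = c\<^sup>2 * (4 * (1 + m) * m / (1 + 2 * m)\<^sup>2)"
    using m by (simp add: power_mult_distrib power_divide)
  also have "4 * (1 + m) * m = (1 + 2 * m)\<^sup>2 - 1"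
    by (simp add: power2_eq_square algebra_simps)
  finally have nw: "(norm w)\<^sup>2 / c\<^sup>2 = 1 - 1 / (1 + 2 * m)\<^sup>2"
    using c m by (simp add: diff_divide_distrib)
  then have "(norm w)\<^sup>2 / c\<^sup>2 < 1" using m by simp
  then have "(norm w)\<^sup>2 < c\<^sup>2" using c by simp
  then have w: "norm w < c" using c by (simp add: power_less_imp_less_base)
  have "lorentz_factor c w = 1 + 2 * m"
    unfolding lorentz_factor_def nw using m by (simp add: real_sqrt_divide)
  then have "half_sinh c w = norm h" by (simp add: half_sinh_def m_def norm_eq_sqrt_inner)
  moreover have "sgn w = sgn h" using c m by (simp add: w_def sgn_scaleR add_pos_pos)
  ultimately have "half_sinh c w *\<^sub>R sgn w = h" using False by (simp add: sgn_div_norm)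
  then show ?thesis using that[OF w] lorentz_boost_half[OF c w] by simp
qed

text \<open>The factor on the left leaves the first row of the boost untouched, and that row gives
  \<gamma> and then \<open>w\<close>. The spatial block of the boost is positive definite, hence
  cancels. This is the uniqueness behind \<open>thomas_wigner_rotation\<close>.\<close>

lemma block_lorentz_inject:
  assumes c: "0 < c" and w: "norm w < c" "norm w' < c"
    and eq: "block 1 0 0 R ** lorentz_boost c w = block 1 0 0 R' ** lorentz_boost c w'"
  shows "R = R'"
proof -
  let ?B = "\<lambda>w. mat 1 + (lorentz_factor c w - 1) *\<^sub>R outer (sgn w) (sgn w)"
  note eqs = eq[unfolded lorentz_boost_block block_mult block_eq_iff]
  have g: "lorentz_factor c w = lorentz_factor c w'" using eqs by simp
  then have "w = w'" using eqs c lorentz_factor_ge_1[OF c w(2)] by simp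
  then have "R ** ?B w = R' ** ?B w" using eqs by simp
  then have "R ** ?B w ** matrix_inv (?B w) = R' ** ?B w ** matrix_inv (?B w)" by simp
  moreover have "?B w ** matrix_inv (?B w) = mat 1"
    using lorentz_factor_ge_1[OF c w(1)] by (intro pos_def_mult_inv pos_def_mat_1_plus_outer) simp
  ultimately show ?thesis by (simp flip: matrix_mul_assoc)
qed

section \<open>Composition of two boosts in half vectors\<close>

context boost_pair
begin

definition s1 where "s1 = half_sinh c u1"
definition s2 where "s2 = half_sinh c u2"
definition E1 where "E1 = sqrt (1 + s1\<^sup>2)"
definition E2 where "E2 = sqrt (1 + s2\<^sup>2)"
text \<open>The half-angle operator of the product of the two boosts is that of a rotation by
  \<open>2 arctan (Y / X)\<close> times that of a boost whose half vector is the vector with coordinates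
  \<open>(E2 s1 + E1 s2 cos \<phi>, E1 s2 sin \<phi>)\<close> rotated back by \<open>arctan (Y / X)\<close>; this is where \<open>p\<close> and \<open>q\<close>
  below come from.\<close>

definition X where "X = E1 * E2 + s1 * s2 * cos \<phi>"
definition Y where "Y = s1 * s2 * sin \<phi>"
definition tw where "tw = 2 * arctan (Y / X)"

lemma s_square: "s1\<^sup>2 = k1 / 2" "s2\<^sup>2 = k2 / 2"
  using half_sinh_square[OF c u1_less] half_sinh_square[OF c u2_less] by (simp_all add: s1_def s2_def k1 k2)

lemma s_pos: "0 < s1" "0 < s2"
  using k_pos by (simp_all add: s1_def s2_def half_sinh_def k1 k2)

lemma E_square: "E1 * E1 = 1 + s1 * s1" "E2 * E2 = 1 + s2 * s2"
  by (simp_all add: E1_def E2_def flip: power2_eq_square)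

text \<open>At worst cos \<phi> = -1, where \<open>X = E1 E2 - s1 s2\<close> is the hyperbolic
  cosine of half the rapidity difference.\<close>

lemma X_ge_1: "1 \<le> X"
proof -
  have "0 \<le> (s1 - s2)\<^sup>2" by simp
  then have "(1 + s1 * s2)\<^sup>2 \<le> (1 + s1\<^sup>2) * (1 + s2\<^sup>2)"
    by (simp add: power2_eq_square algebra_simps)
  then have "1 + s1 * s2 \<le> sqrt ((1 + s1\<^sup>2) * (1 + s2\<^sup>2))" by (rule real_le_rsqrt)
  then have "1 + s1 * s2 \<le> E1 * E2" by (simp add: E1_def E2_def real_sqrt_mult)
  moreover have "- (s1 * s2) \<le> s1 * s2 * cos \<phi>"
    using s_pos mult_left_mono[of "-1" "cos \<phi>" "s1 * s2"] by simp
  ultimately show ?thesis by (simp add: X_def)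
qed

text \<open>The squared hyperbolic cosine of half the resulting rapidity; (X, Y) is
  \<open>sqrt G\<close> times the cosine and sine of half the rotation angle.\<close>

definition G where "G = X * X + Y * Y"

lemma G_pos: "0 < G"
  using X_ge_1 by (simp add: G_def add_pos_nonneg)

lemma cos_sin_tw: "cos tw = (X * X - Y * Y) / G" "sin tw = 2 * X * Y / G"
proof -
  have X: "X \<noteq> 0" using X_ge_1 by simp
  then have t: "1 + (Y / X)\<^sup>2 = G / X\<^sup>2" "1 - (Y / X)\<^sup>2 = (X * X - Y * Y) / X\<^sup>2"
    by (simp_all add: G_def field_simps power2_eq_square)
  have "cos (2 * arctan t) = (1 - t\<^sup>2) / (1 + t\<^sup>2)" "sin (2 * arctan t) = 2 * t / (1 + t\<^sup>2)" for t :: real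
  proof -
    have "sqrt (1 + t\<^sup>2) * sqrt (1 + t\<^sup>2) = 1 + t\<^sup>2" by simp
    then show "cos (2 * arctan t) = (1 - t\<^sup>2) / (1 + t\<^sup>2)" "sin (2 * arctan t) = 2 * t / (1 + t\<^sup>2)"
      by (simp_all add: cos_double sin_double cos_arctan sin_arctan power_divide diff_divide_distrib)
  qed
  then have "cos tw = (1 - (Y / X)\<^sup>2) / (1 + (Y / X)\<^sup>2)" "sin tw = 2 * (Y / X) / (1 + (Y / X)\<^sup>2)"
    unfolding tw_def by blast+
  then show "cos tw = (X * X - Y * Y) / G" "sin tw = 2 * X * Y / G"
    unfolding t using X by (simp_all add: power2_eq_square)
qed

definition p where "p = (1 + 2 * (s2 * s2)) * (E1 * s1) + E2 * (s2 * cos \<phi>) * (1 + 2 * (s1 * s1))"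
definition q where "q = E2 * s2 * sin \<phi>"
definition h where "h = (p / sqrt G) *\<^sub>R e1 + (q / sqrt G) *\<^sub>R e2"

lemma S_square: "sin \<phi> * sin \<phi> = 1 - cos \<phi> * cos \<phi>"
  by (metis sin_squared_eq power2_eq_square)

text \<open>In a right-nested longer product a square appears as \<open>E1 * (E1 * x)\<close>, where
  the plain rules for squares do not match.\<close>

lemma reduce: "E1 * (E1 * x) = (1 + s1 * s1) * x" "E2 * (E2 * x) = (1 + s2 * s2) * x"
    "sin \<phi> * (sin \<phi> * x) = (1 - cos \<phi> * cos \<phi>) * x"
  by (simp_all add: E_square S_square flip: mult.assoc)

text \<open>These rules normalize polynomials modulo \<open>E1\<^sup>2 = 1 + s1\<^sup>2\<close>, \<open>E2\<^sup>2 = 1 + s2\<^sup>2\<close> and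
  \<open>sin\<^sup>2 + cos\<^sup>2 = 1\<close>, which decides the identities below.\<close>

lemmas poly = E_square S_square reduce X_def Y_def G_def p_def q_def algebra_simps

lemma pq_square: "p * p + q * q = (G - 1) * G"
  by (simp add: poly)

text \<open>The hyperbolic law of cosines: \<open>2 G - 1\<close> is the \<gamma> of the resulting
  boost, and \<open>2 E1 s1\<close>, \<open>2 E2 s2\<close> are the hyperbolic sines of the two
  rapidities.\<close>

lemma G_eq: "2 * G - 1 = (1 + 2 * (s1 * s1)) * (1 + 2 * (s2 * s2)) + 4 * E1 * E2 * (s1 * s2 * cos \<phi>)"
  by (simp add: poly)

lemma rot_p: "(X * X - Y * Y) * p - 2 * X * Y * q
    = G * ((1 + 2 * (s1 * s1)) * (E2 * s2 * cos \<phi>) + E1 * s1 * (1 + 2 * (s2 * s2) * (cos \<phi> * cos \<phi>)))"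
  by (simp add: poly)

lemma rot_q: "2 * X * Y * p + (X * X - Y * Y) * q
    = G * ((1 + 2 * (s1 * s1)) * (E2 * s2 * sin \<phi>) + E1 * s1 * (2 * (s2 * s2) * (cos \<phi> * sin \<phi>)))"
  by (simp add: poly)

text \<open>Up to the factor \<open>- 2 c\<close> the right side is the time column of the product
  of the boosts. The rotation acts from the left, so the column is rotated while the time row shows
  (p, q) itself.\<close>

lemma rotated_pq:
  "planar_rot e1 e2 tw *v (p *\<^sub>R e1 + q *\<^sub>R e2)
     = ((1 + 2 * (s1 * s1)) * (E2 * s2 * cos \<phi>) + E1 * s1 * (1 + 2 * (s2 * s2) * (cos \<phi> * cos \<phi>))) *\<^sub>R e1
     + ((1 + 2 * (s1 * s1)) * (E2 * s2 * sin \<phi>) + E1 * s1 * (2 * (s2 * s2) * (cos \<phi> * sin \<phi>))) *\<^sub>R e2"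
  (is "_ = ?a *\<^sub>R e1 + ?b *\<^sub>R e2")
proof -
  have "cos tw * p - sin tw * q = ?a" "sin tw * p + cos tw * q = ?b"
    using rot_p rot_q G_pos unfolding cos_sin_tw
    by (simp_all add: field_simps flip: diff_divide_distrib add_divide_distrib)
  then show ?thesis by (simp add: planar_vec_frame)
qed

text \<open>\<open>G\<close> times the entries of the spatial block: on the left those of
  \<open>R (1 + 2 h h^T)\<close>, using \<open>sqrt G R h = (a, b)\<close>, on the right those of
  the product of the boosts.\<close>

lemma product_entries:
  fixes a b :: real
  defines "a \<equiv> (1 + 2 * (s1 * s1)) * (E2 * s2 * cos \<phi>) + E1 * s1 * (1 + 2 * (s2 * s2) * (cos \<phi> * cos \<phi>))"
    and "b \<equiv> (1 + 2 * (s1 * s1)) * (E2 * s2 * sin \<phi>) + E1 * s1 * (2 * (s2 * s2) * (cos \<phi> * sin \<phi>))"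
  shows "X * X - Y * Y + 2 * (a * p)
      = G * (4 * E1 * E2 * (s1 * s2 * cos \<phi>) + (1 + 2 * (s2 * s2) * (cos \<phi> * cos \<phi>)) * (1 + 2 * (s1 * s1)))"
    and "- (2 * X * Y) + 2 * (a * q) = G * (2 * (s2 * s2) * (cos \<phi> * sin \<phi>))"
    and "2 * X * Y + 2 * (b * p)
      = G * (4 * E1 * E2 * (s1 * s2 * sin \<phi>) + 2 * (s2 * s2) * (cos \<phi> * sin \<phi>) * (1 + 2 * (s1 * s1)))"
    and "X * X - Y * Y + 2 * (b * q) = G * (1 + 2 * (s2 * s2) * (sin \<phi> * sin \<phi>))"
  unfolding a_def b_def by (simp_all add: poly)

lemma half_vectors: "s1 *\<^sub>R sgn u1 = s1 *\<^sub>R e1"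
  "s2 *\<^sub>R sgn u2 = (s2 * cos \<phi>) *\<^sub>R e1 + (s2 * sin \<phi>) *\<^sub>R e2"
  by (simp_all add: sgn_u1 sgn_u2 algebra_simps)

text \<open>Equality is checked block by block: the corner is the law of cosines, the time row gives
  (p, q), the column is (p, q) rotated, and the spatial block is
  \<open>product_entries\<close>.\<close>

lemma boost_product:
  "lorentz_boost c u2 ** lorentz_boost c u1 = block 1 0 0 (planar_rot e1 e2 tw) ** half_boost c h"
proof -
  let ?h1 = "s1 *\<^sub>R e1" and ?h2 = "(s2 * cos \<phi>) *\<^sub>R e1 + (s2 * sin \<phi>) *\<^sub>R e2"
  let ?R = "planar_rot e1 e2 tw"
  define B1 where "B1 = planar e1 e2 (1 + 2 * (s1 * s1)) 0 0 1"
  define B2 where "B2 = planar e1 e2 (1 + 2 * (s2 * s2) * (cos \<phi> * cos \<phi>)) (2 * (s2 * s2) * (cos \<phi> * sin \<phi>))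
    (2 * (s2 * s2) * (cos \<phi> * sin \<phi>)) (1 + 2 * (s2 * s2) * (sin \<phi> * sin \<phi>))"
  have B1: "mat 1 + 2 *\<^sub>R outer ?h1 ?h1 = B1"
    using mat_1_plus_outer_planar[of 2 s1 e1 0 e2] by (simp add: B1_def power2_eq_square)
  have B2: "mat 1 + 2 *\<^sub>R outer ?h2 ?h2 = B2"
    unfolding mat_1_plus_outer_planar B2_def by (simp add: power2_eq_square ac_simps)
  have i1: "?h1 \<bullet> ?h1 = s1 * s1" by (simp add: frame_inner)
  have i2: "?h2 \<bullet> ?h2 = s2 * s2"
    by (simp add: frame_inner S_square algebra_simps reduce)
  have E: "sqrt (1 + s1 * s1) = E1" "sqrt (1 + s2 * s2) = E2"
    by (simp_all add: E1_def E2_def power2_eq_square)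
  have l1: "lorentz_boost c u1 = block (1 + 2 * (s1 * s1)) (- (2 * E1 / c) *\<^sub>R ?h1) (- (2 * E1 * c) *\<^sub>R ?h1) B1"
    using lorentz_boost_half[OF c u1_less]
    unfolding s1_def[symmetric] half_vectors half_boost_def i1 E B1 .
  have l2: "lorentz_boost c u2 = block (1 + 2 * (s2 * s2)) (- (2 * E2 / c) *\<^sub>R ?h2) (- (2 * E2 * c) *\<^sub>R ?h2) B2"
    using lorentz_boost_half[OF c u2_less]
    unfolding s2_def[symmetric] half_vectors half_boost_def i2 E B2 .
  have G: "sqrt G * sqrt G = G" using G_pos by simp
  have ih: "h \<bullet> h = G - 1"
    using pq_square G G_pos
    by (simp add: h_def frame_inner flip: add_divide_distrib)
  have Eh: "sqrt (1 + h \<bullet> h) *\<^sub>R h = p *\<^sub>R e1 + q *\<^sub>R e2"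
  proof -
    have "sqrt (1 + h \<bullet> h) = sqrt G" by (simp add: ih)
    then show ?thesis using G_pos by (simp add: h_def scaleR_add_right)
  qed
  have hb: "half_boost c h = block (2 * G - 1) (- (2 / c) *\<^sub>R (p *\<^sub>R e1 + q *\<^sub>R e2))
      (- (2 * c) *\<^sub>R (p *\<^sub>R e1 + q *\<^sub>R e2)) (mat 1 + 2 *\<^sub>R outer h h)"
    unfolding half_boost_def Eh[symmetric] by (simp add: ih ac_simps)
  have row: "?h2 v* B1 = B1 *v ?h2"
    by (rule symmetric_vec_mult) (simp add: B1_def transpose_planar)
  define a b where "a = (1 + 2 * (s1 * s1)) * (E2 * s2 * cos \<phi>) + E1 * s1 * (1 + 2 * (s2 * s2) * (cos \<phi> * cos \<phi>))"
    and "b = (1 + 2 * (s1 * s1)) * (E2 * s2 * sin \<phi>) + E1 * s1 * (2 * (s2 * s2) * (cos \<phi> * sin \<phi>))"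
  note Rpq = rotated_pq[folded a_def b_def]
  have timetime: "(1 + 2 * (s2 * s2)) * (1 + 2 * (s1 * s1))
      + (- (2 * E2 / c) *\<^sub>R ?h2) \<bullet> (- (2 * E1 * c) *\<^sub>R ?h1) = 2 * G - 1"
    using c by (simp add: G_eq frame_inner)
  have timerow: "(1 + 2 * (s2 * s2)) *\<^sub>R (- (2 * E1 / c) *\<^sub>R ?h1) + (- (2 * E2 / c) *\<^sub>R ?h2) v* B1
      = - (2 / c) *\<^sub>R (p *\<^sub>R e1 + q *\<^sub>R e2)"
  proof -
    have "(- (2 * E2 / c) *\<^sub>R ?h2) v* B1 = - (2 / c) *\<^sub>R (E2 *\<^sub>R (B1 *v ?h2))"
      unfolding scaleR_vector_matrix_assoc row by simp
    also have "B1 *v ?h2 = ((1 + 2 * (s1 * s1)) * (s2 * cos \<phi>)) *\<^sub>R e1 + (s2 * sin \<phi>) *\<^sub>R e2"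
      unfolding B1_def planar_vec_frame by simp
    finally have r: "(- (2 * E2 / c) *\<^sub>R ?h2) v* B1
      = - (2 / c) *\<^sub>R (E2 *\<^sub>R (((1 + 2 * (s1 * s1)) * (s2 * cos \<phi>)) *\<^sub>R e1 + (s2 * sin \<phi>) *\<^sub>R e2))" .
    have "(1 + 2 * (s2 * s2)) *\<^sub>R (E1 *\<^sub>R ?h1)
      + E2 *\<^sub>R (((1 + 2 * (s1 * s1)) * (s2 * cos \<phi>)) *\<^sub>R e1 + (s2 * sin \<phi>) *\<^sub>R e2) = p *\<^sub>R e1 + q *\<^sub>R e2"
      by (simp add: p_def q_def algebra_simps)
    then have "- (2 / c) *\<^sub>R ((1 + 2 * (s2 * s2)) *\<^sub>R (E1 *\<^sub>R ?h1)
      + E2 *\<^sub>R (((1 + 2 * (s1 * s1)) * (s2 * cos \<phi>)) *\<^sub>R e1 + (s2 * sin \<phi>) *\<^sub>R e2))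
      = - (2 / c) *\<^sub>R (p *\<^sub>R e1 + q *\<^sub>R e2)" by (rule arg_cong)
    moreover have "(1 + 2 * (s2 * s2)) *\<^sub>R (- (2 * E1 / c) *\<^sub>R ?h1)
        = - (2 / c) *\<^sub>R ((1 + 2 * (s2 * s2)) *\<^sub>R (E1 *\<^sub>R ?h1))"
      unfolding scaleR_scaleR by (simp add: ac_simps)
    ultimately show ?thesis unfolding r scaleR_add_right[of "- (2 / c)"] by (simp only:)
  qed
  have column: "(1 + 2 * (s1 * s1)) *\<^sub>R (- (2 * E2 * c) *\<^sub>R ?h2) + B2 *v (- (2 * E1 * c) *\<^sub>R ?h1)
      = ?R *v (- (2 * c) *\<^sub>R (p *\<^sub>R e1 + q *\<^sub>R e2))"
  proof -
    have "B2 *v ?h1 = ((1 + 2 * (s2 * s2) * (cos \<phi> * cos \<phi>)) * s1) *\<^sub>R e1 + (2 * (s2 * s2) * (cos \<phi> * sin \<phi>) * s1) *\<^sub>R e2"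
      using planar_vec_frame[of _ _ _ _ s1 0] by (simp add: B2_def)
    then have "(1 + 2 * (s1 * s1)) *\<^sub>R (- (2 * E2 * c) *\<^sub>R ?h2) + B2 *v (- (2 * E1 * c) *\<^sub>R ?h1)
        = - (2 * c) *\<^sub>R (a *\<^sub>R e1 + b *\<^sub>R e2)"
      unfolding matrix_vector_mult_scaleR by (simp add: a_def b_def algebra_simps)
    also have "\<dots> = ?R *v (- (2 * c) *\<^sub>R (p *\<^sub>R e1 + q *\<^sub>R e2))"
      unfolding matrix_vector_mult_scaleR Rpq ..
    finally show ?thesis .
  qed
  have space: "outer (- (2 * E2 * c) *\<^sub>R ?h2) (- (2 * E1 / c) *\<^sub>R ?h1) + B2 ** B1
      = ?R ** (mat 1 + 2 *\<^sub>R outer h h)"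
  proof -
    have hh: "mat 1 + 2 *\<^sub>R outer h h = planar e1 e2 (1 + 2 * (p * p) / G) (2 * (p * q) / G)
        (2 * (p * q) / G) (1 + 2 * (q * q) / G)"
      unfolding h_def mat_1_plus_outer_planar using G_pos by (simp add: power2_eq_square mult.assoc)
    have cs: "cos tw * p - sin tw * q = a" "sin tw * p + cos tw * q = b"
      using arg_cong[OF Rpq, of "\<lambda>x. e1 \<bullet> x"] arg_cong[OF Rpq, of "\<lambda>x. e2 \<bullet> x"]
      by (simp_all add: planar_vec_frame frame_inner)
    have "?R ** (mat 1 + 2 *\<^sub>R outer h h) = planar e1 e2 (cos tw + 2 * (a * p) / G) (- sin tw + 2 * (a * q) / G)
        (sin tw + 2 * (b * p) / G) (cos tw + 2 * (b * q) / G)"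
    proof -
      have "cos tw * (2 * (p * x) / G) - sin tw * (2 * (q * x) / G) = 2 * (a * x) / G"
        "sin tw * (2 * (p * x) / G) + cos tw * (2 * (q * x) / G) = 2 * (b * x) / G" for x
        unfolding cs[symmetric] by (simp_all add: algebra_simps add_divide_distrib diff_divide_distrib)
      from this[of p] this[of q] show ?thesis
        unfolding hh planar_mult by (simp add: algebra_simps)
    qed
    also have "\<dots> = planar e1 e2
        (4 * E1 * E2 * (s1 * s2 * cos \<phi>) + (1 + 2 * (s2 * s2) * (cos \<phi> * cos \<phi>)) * (1 + 2 * (s1 * s1)))
        (2 * (s2 * s2) * (cos \<phi> * sin \<phi>))
        (4 * E1 * E2 * (s1 * s2 * sin \<phi>) + 2 * (s2 * s2) * (cos \<phi> * sin \<phi>) * (1 + 2 * (s1 * s1)))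
        (1 + 2 * (s2 * s2) * (sin \<phi> * sin \<phi>))"
    proof -
      have div: "x / G = y" if "x = G * y" for x y using that G_pos by simp
      show ?thesis
        unfolding cos_sin_tw minus_divide_left add_divide_distrib[symmetric]
        using product_entries[folded a_def b_def, THEN div] by simp
    qed
    also have "\<dots> = outer (- (2 * E2 * c) *\<^sub>R ?h2) (- (2 * E1 / c) *\<^sub>R ?h1) + B2 ** B1"
    proof -
      have "outer (- (2 * E2 * c) *\<^sub>R ?h2) (- (2 * E1 / c) *\<^sub>R ?h1)
        = outer ((s2 * cos \<phi>) *\<^sub>R e1 + (s2 * sin \<phi>) *\<^sub>R e2) ((4 * E1 * E2 * s1) *\<^sub>R e1 + 0 *\<^sub>R e2)"
        using c by (simp add: outer_def vec_eq_iff algebra_simps)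
      then show ?thesis
        unfolding B1_def B2_def planar_mult add.commute[of "outer _ _"]
        by (simp only: planar_plus_outer) (simp add: algebra_simps)
    qed
    finally show ?thesis by simp
  qed
  show ?thesis
    unfolding l1 l2 hb block_mult timetime timerow column space by simp
qed

lemma thomas_wigner_boost_pair: "thomas_wigner_angle c u1 u2 = tw"
proof -
  have R: "thomas_wigner_rotation c u1 u2 = planar_rot e1 e2 tw"
    unfolding thomas_wigner_rotation_def
  proof (rule the_equality)
    obtain w where w: "norm w < c" "lorentz_boost c w = half_boost c h"
      using half_boost_lorentz[OF c] by blast
    then have eq: "lorentz_boost c u2 ** lorentz_boost c u1 = block 1 0 0 (planar_rot e1 e2 tw) ** lorentz_boost c w"
      by (simp add: boost_product)
    with w rotation_planar_rot show "rotation_matrix (planar_rot e1 e2 tw) \<and> (\<exists>w. norm w < c \<and>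
       lorentz_boost c u2 ** lorentz_boost c u1 = block 1 0 0 (planar_rot e1 e2 tw) ** lorentz_boost c w)"
      by blast
    fix R assume "rotation_matrix R \<and> (\<exists>w. norm w < c \<and>
       lorentz_boost c u2 ** lorentz_boost c u1 = block 1 0 0 R ** lorentz_boost c w)"
    then obtain w' where "norm w' < c"
      "lorentz_boost c u2 ** lorentz_boost c u1 = block 1 0 0 R ** lorentz_boost c w'" by blast
    with w eq show "R = planar_rot e1 e2 tw" by (intro block_lorentz_inject[OF c, of w' w]) auto
  qed
  have bounds: "- pi < tw" "tw \<le> pi"
    using arctan_bounded[of "Y / X"] by (auto simp: tw_def)
  show ?thesis
    unfolding thomas_wigner_angle_def R
    by (rule rotation_angle_frame[OF bounds]) (simp add: tw_def Y_def)
qed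

end

section \<open>Estimates for small Mach number\<close>

text \<open>Here \<open>1 + k = (1 - x)^(-1/2)\<close>. The polynomial bounds are verified by
  squaring and multiplying by \<open>1 - x\<close>: the lower one then gives at most 1, the upper
  one at least 1.\<close>

lemma boost_excess_bounds:
  fixes k x :: real
  assumes k: "0 \<le> k" and x: "0 \<le> x" "x \<le> 1 / 4" and eq: "(1 + k)\<^sup>2 * (1 - x) = 1"
  shows "x / 2 \<le> k" "k \<le> x / 2 + x\<^sup>2" "k \<le> x"
proof -
  have x1: "0 < 1 - x" using x by simp
  have "(1 + x / 2)\<^sup>2 * (1 - x) = 1 - x\<^sup>2 * (3 / 4 + x / 4)"
    by (simp add: power2_eq_square field_simps)
  also have "\<dots> \<le> (1 + k)\<^sup>2 * (1 - x)" using x eq by simp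
  finally have "(1 + x / 2)\<^sup>2 \<le> (1 + k)\<^sup>2" using x1 by simp
  then have "1 + x / 2 \<le> 1 + k" by (rule power2_le_imp_le) (use k in simp)
  then show "x / 2 \<le> k" by simp
  have "x ^ 3 \<le> 1 / 4" using power_le_one[of x 3] mult_mono[of x "1/4" "x\<^sup>2" 1] x
    by (simp add: power3_eq_cube power2_eq_square mult_le_one)
  then have "0 \<le> x\<^sup>2 * (5 / 4 - 5 / 4 * x - x ^ 3)" using x by simp
  also have "\<dots> = (1 + (x / 2 + x\<^sup>2))\<^sup>2 * (1 - x) - 1"
    by (simp add: power2_eq_square power3_eq_cube field_simps)
  finally have "(1 + k)\<^sup>2 * (1 - x) \<le> (1 + (x / 2 + x\<^sup>2))\<^sup>2 * (1 - x)" using eq by simp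
  then have "(1 + k)\<^sup>2 \<le> (1 + (x / 2 + x\<^sup>2))\<^sup>2" using x1 by simp
  then have "1 + k \<le> 1 + (x / 2 + x\<^sup>2)" by (rule power2_le_imp_le) (use x in simp)
  then show "k \<le> x / 2 + x\<^sup>2" by simp
  moreover have "x * x \<le> x * (1 / 4)" using x by (intro mult_left_mono)
  ultimately show "k \<le> x" using x unfolding power2_eq_square by linarith
qed

lemma arctan_cubic_bound:
  fixes t :: real
  assumes "\<bar>t\<bar> < 1"
  shows "\<bar>arctan t - t\<bar> \<le> \<bar>t\<bar> ^ 3 / 3"
proof -
  have pos: "\<bar>arctan t - t\<bar> \<le> t ^ 3 / 3" if "0 \<le> t" "t < 1" for t :: real
    using arctan_lower_bound[OF that, of 1] arctan_le_self[OF that(1)]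
    by (simp add: eval_nat_numeral)
  show ?thesis
  proof (cases "0 \<le> t")
    case True
    then show ?thesis using pos[of t] assms by simp
  next
    case False
    then show ?thesis using pos[of "- t"] assms by (simp add: arctan_minus abs_if split: if_splits)
  qed
qed

lemma arctan_ge_half:
  fixes t :: real
  assumes "0 \<le> t" "t < 1"
  shows "t / 2 \<le> arctan t"
proof -
  have "t * t\<^sup>2 \<le> t * 1" using assms by (intro mult_left_mono power_le_one) auto
  then have "t ^ 3 \<le> t" by (simp add: power3_eq_cube power2_eq_square)
  moreover have "\<bar>arctan t - t\<bar> \<le> t ^ 3 / 3" using arctan_cubic_bound[of t] assms by simp
  ultimately show ?thesis using assms(1) by linarith
qed

lemma mach_bounds:
  assumes "0 < c"
  shows "norm u1 / c \<le> mach c u1 u2" "norm u2 / c \<le> mach c u1 u2" "0 \<le> mach c u1 u2"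
  using assms by (auto simp: mach_def divide_right_mono le_max_iff_disj)

section \<open>Bounds uniform in the directions of the steps\<close>

context boost_pair
begin

definition b1 where "b1 = norm u1 / c"
definition b2 where "b2 = norm u2 / c"

lemma b_pos: "0 < b1" "0 < b2"
  using c u1_nonzero u2_nonzero by (simp_all add: b1_def b2_def)

context
  fixes M assumes M: "M = mach c u1 u2" and M_small: "M < 1 / 8"
begin

lemma b_le: "b1 \<le> M" "b2 \<le> M"
  using mach_bounds[OF c] by (simp_all add: b1_def b2_def M)

lemma M_pos: "0 < M"
  using b_le b_pos by linarith

lemma M_square: "M\<^sup>2 \<le> 1 / 4"
  using M_pos M_small mult_mono[of M "1/8" M "1/8"] by (simp add: power2_eq_square)

lemma b_square_le: "b1\<^sup>2 \<le> M\<^sup>2" "b2\<^sup>2 \<le> M\<^sup>2"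
  using b_le b_pos by (simp_all add: power_mono)

lemma k_bounds:
  "b1\<^sup>2 / 2 \<le> k1" "k1 \<le> b1\<^sup>2 / 2 + (b1\<^sup>2)\<^sup>2" "k1 \<le> b1\<^sup>2"
  "b2\<^sup>2 / 2 \<le> k2" "k2 \<le> b2\<^sup>2 / 2 + (b2\<^sup>2)\<^sup>2" "k2 \<le> b2\<^sup>2"
proof -
  have "(1 + k1)\<^sup>2 * (1 - b1\<^sup>2) = 1" "(1 + k2)\<^sup>2 * (1 - b2\<^sup>2) = 1"
    using lorentz_factor_square[OF c u1_less] lorentz_factor_square[OF c u2_less]
    by (simp_all add: k1 k2 b1_def b2_def power_divide)
  moreover have "b1\<^sup>2 \<le> 1 / 4" "b2\<^sup>2 \<le> 1 / 4" using b_square_le M_square by linarith+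
  ultimately show "b1\<^sup>2 / 2 \<le> k1" "k1 \<le> b1\<^sup>2 / 2 + (b1\<^sup>2)\<^sup>2" "k1 \<le> b1\<^sup>2"
    "b2\<^sup>2 / 2 \<le> k2" "k2 \<le> b2\<^sup>2 / 2 + (b2\<^sup>2)\<^sup>2" "k2 \<le> b2\<^sup>2"
    using boost_excess_bounds[of k1 "b1\<^sup>2"] boost_excess_bounds[of k2 "b2\<^sup>2"] k_pos by simp_all
qed

lemma k_le: "k1 \<le> M\<^sup>2" "k2 \<le> M\<^sup>2"
  using k_bounds b_square_le by linarith+

lemma q00_pos_small: "0 < q00 c u1 u2"
proof (rule q00_pos)
  have k: "k1 \<le> 1 / 4" "k2 \<le> 1 / 4" using k_le M_square by linarith+
  let ?B = "planar e1 e2 (1 + k1) 0 0 1"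
  have "norm (?B *v u2) \<le> (1 + k1) * norm u2"
  proof -
    have "?B *v u2 = u2 + (k1 * (e1 \<bullet> u2)) *\<^sub>R e1"
      by (simp add: planar_vec)
    also have "norm \<dots> \<le> norm u2 + k1 * \<bar>e1 \<bullet> u2\<bar>"
      using norm_triangle_ineq[of u2 "(k1 * (e1 \<bullet> u2)) *\<^sub>R e1"] k_pos e11
      by (simp add: norm_eq_1[symmetric] abs_mult)
    also have "\<dots> \<le> norm u2 + k1 * norm u2"
      using Cauchy_Schwarz_ineq2[of e1 u2] k_pos e11 by (simp add: norm_eq_1[symmetric])
    finally show ?thesis by (simp add: algebra_simps)
  qed
  also have "\<dots> \<le> 2 * norm u2" using k by (intro mult_right_mono) auto
  finally have B: "norm (?B *v u2) \<le> 2 * norm u2" .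
  have coeff: "(1 + k1) / (1 + k2) \<le> 2" using k k_pos by (simp add: field_simps)
  have "c\<^sup>2 *\<^sub>R time_row = ((1 + k1) / (1 + k2)) *\<^sub>R u1 + (1 + k2) *\<^sub>R (?B *v u2)"
    using c k_pos by (simp add: time_row_def scaleR_add_right)
  then have "c\<^sup>2 * norm time_row = norm (((1 + k1) / (1 + k2)) *\<^sub>R u1 + (1 + k2) *\<^sub>R (?B *v u2))"
    by (metis abs_of_nonneg norm_scaleR zero_le_power2)
  also have "\<dots> \<le> (1 + k1) / (1 + k2) * norm u1 + (1 + k2) * norm (?B *v u2)"
    using norm_triangle_ineq[of "((1 + k1) / (1 + k2)) *\<^sub>R u1" "(1 + k2) *\<^sub>R (?B *v u2)"] k_pos
    by simp
  also have "\<dots> \<le> 2 * norm u1 + 2 * (2 * norm u2)"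
    using coeff B k k_pos by (intro add_mono mult_mono) auto
  \<comment> \<open>\<open>2 b1 + 4 b2 \<le> 6 M\<close>, which is below 1 because
    \<open>M < 1/8\<close>.\<close>
  also have "\<dots> = c * (2 * b1 + 4 * b2)" using c by (simp add: b1_def b2_def algebra_simps)
  also have "\<dots> < c * 1" using c b_le M_small by (intro mult_strict_left_mono) auto
  finally show "c * norm time_row < 1" using c by (simp add: power2_eq_square)
qed

lemma D_bounds: "2 \<le> D" "D \<le> 2 + k1 + k2 + k1 * k2"
proof -
  have "(cos \<phi>)\<^sup>2 \<le> 1" by (simp add: abs_square_le_1)
  then have "k1 * k2 * (cos \<phi>)\<^sup>2 \<le> k1 * k2 * 1" using k_pos by (intro mult_left_mono) auto
  then show "2 \<le> D" "D \<le> 2 + k1 + k2 + k1 * k2" using k_pos by (simp_all add: D_def)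
qed

text \<open>Only cos \<phi> is estimated away; the factor sin \<phi> is what the comparison with the
  Thomas--Wigner angle uses.\<close>

lemma angle_le: "\<bar>angle\<bar> \<le> k1 * k2 * sin \<phi> / 2" and tan_le: "\<bar>N / D\<bar> \<le> k1 * k2 * sin \<phi> / 2"
  and angle_tan: "angle = arctan (N / D)"
proof -
  show eq: "angle = arctan (N / D)" by (simp add: angle_def holonomy_tan_def N_def D_def)
  have "\<bar>N\<bar> = k1 * k2 * sin \<phi> * \<bar>cos \<phi>\<bar>"
    using k_pos sin_phi_nonneg by (simp add: N_def abs_mult)
  also have "\<dots> \<le> k1 * k2 * sin \<phi> * 1"
    using k_pos sin_phi_nonneg by (intro mult_left_mono) auto
  finally have "\<bar>N / D\<bar> \<le> k1 * k2 * sin \<phi> / D"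
    using D_bounds by (simp add: divide_right_mono)
  also have "\<dots> \<le> k1 * k2 * sin \<phi> / 2"
    using D_bounds k_pos sin_phi_nonneg by (intro divide_left_mono) auto
  finally show t: "\<bar>N / D\<bar> \<le> k1 * k2 * sin \<phi> / 2" .
  then show "\<bar>angle\<bar> \<le> k1 * k2 * sin \<phi> / 2"
    unfolding eq using abs_arctan_le[of "N / D"] by linarith
qed

lemma k_product_le: "k1 * k2 \<le> M ^ 4"
proof -
  have "k1 * k2 \<le> M\<^sup>2 * M\<^sup>2" using k_le k_pos by (intro mult_mono) auto
  then show ?thesis by (simp flip: power_add)
qed

lemma k_product_sin_le: "k1 * k2 * sin \<phi> / 2 \<le> M ^ 4 / 2"
proof -
  have "k1 * k2 * sin \<phi> \<le> k1 * k2 * 1" using k_pos by (intro mult_left_mono) auto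
  then show ?thesis using k_product_le by simp
qed

lemma angle_le_M4: "\<bar>angle\<bar> \<le> M ^ 4"
  using angle_le k_product_sin_le M_pos zero_less_power[OF M_pos, of 4] by linarith

text \<open>The leading term is \<open>N / 2\<close>. Replacing arctan by its argument costs order
  \<open>M^12\<close>; replacing \<open>D\<close> by 2 costs a relative error of order
  \<open>M^2\<close> on a quantity of order \<open>M^4\<close>, and this decides the bound.\<close>

lemma angle_leading: "\<bar>angle - leading_angle (1 + k1) (1 + k2) \<phi>\<bar> \<le> 2 * M ^ 6"
proof -
  have M1: "M ^ 4 \<le> 1" "M\<^sup>2 \<le> 1" "M ^ 6 \<le> 1" using M_pos M_small by (simp_all add: power_le_one)
  have lead: "leading_angle (1 + k1) (1 + k2) \<phi> = N / 2"
    by (simp add: leading_angle_def N_def sin_double)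
  have small: "\<bar>N / D\<bar> \<le> M ^ 4 / 2" using tan_le k_product_sin_le by linarith
  then have "\<bar>N / D\<bar> < 1" using M1 by linarith
  then have "\<bar>angle - N / D\<bar> \<le> \<bar>N / D\<bar> ^ 3 / 3" unfolding angle_tan by (rule arctan_cubic_bound)
  also have "\<dots> \<le> (M ^ 4 / 2) ^ 3 / 3"
    using small by (intro divide_right_mono power_mono) auto
  also have "\<dots> \<le> (M ^ 4) ^ 3" using M_pos by (simp add: power_divide)
  also have "\<dots> = M ^ 6 * M ^ 6" by (simp flip: power_mult power_add)
  also have "\<dots> \<le> M ^ 6 * 1" using M1 M_pos by (intro mult_left_mono) auto
  finally have 1: "\<bar>angle - N / D\<bar> \<le> M ^ 6" by simp
  have "N / D - N / 2 = N / D * ((2 - D) / 2)" using D_bounds by (simp add: field_simps)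
  then have "\<bar>N / D - N / 2\<bar> = \<bar>N / D\<bar> * ((D - 2) / 2)" using D_bounds by (simp add: abs_mult)
  also have "\<dots> \<le> M ^ 4 / 2 * ((k1 + k2 + k1 * k2) / 2)"
    using small D_bounds by (intro mult_mono) auto
  also have "\<dots> \<le> M ^ 4 / 2 * ((M\<^sup>2 + M\<^sup>2 + M\<^sup>2) / 2)"
  proof -
    have "k1 * k2 \<le> M\<^sup>2 * 1" using k_le k_pos M1 by (intro mult_mono) auto
    then show ?thesis using k_le by (intro mult_left_mono divide_right_mono add_mono) auto
  qed
  also have "\<dots> = 3 / 4 * (M ^ 4 * M\<^sup>2)" by simp
  also have "M ^ 4 * M\<^sup>2 = M ^ 6" by (simp flip: power_add)
  also have "3 / 4 * M ^ 6 \<le> M ^ 6" using M_pos by simp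
  finally show ?thesis using 1 unfolding lead by linarith
qed

text \<open>With \<open>k1 = x/2 + e\<close> and \<open>k2 = y/2 + f\<close>, where \<open>e\<close>
  and \<open>f\<close> are of order \<open>M^4\<close>, the product \<open>k1 k2\<close> differs
  from \<open>x y / 4\<close> by terms of order at least 6.\<close>

lemma leading_expansion:
  "\<bar>leading_angle (1 + k1) (1 + k2) \<phi> - b1\<^sup>2 * b2\<^sup>2 / 16 * sin (2 * \<phi>)\<bar> \<le> 2 * M ^ 6"
proof -
  define x y where "x = b1\<^sup>2" and "y = b2\<^sup>2"
  define e f where "e = k1 - x / 2" and "f = k2 - y / 2"
  have xy: "0 \<le> x" "0 \<le> y" "x \<le> M\<^sup>2" "y \<le> M\<^sup>2" using b_square_le by (simp_all add: x_def y_def)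
  have ef: "0 \<le> e" "0 \<le> f" "e \<le> x\<^sup>2" "f \<le> y\<^sup>2"
    using k_bounds by (simp_all add: e_def f_def x_def y_def)
  have x2: "x\<^sup>2 \<le> M ^ 4" "y\<^sup>2 \<le> M ^ 4"
    using power_mono[OF xy(3), of 2] power_mono[OF xy(4), of 2] xy by (simp_all flip: power_mult)
  have ef4: "e \<le> M ^ 4" "f \<le> M ^ 4" using ef x2 by linarith+
  have "M ^ 4 \<le> M\<^sup>2" using M_pos M_small by (intro power_decreasing) auto
  then have f2: "f \<le> M\<^sup>2" using ef4 by linarith
  have b: "x * f \<le> M ^ 6" "y * e \<le> M ^ 6" "f * e \<le> M ^ 6"
    using mult_mono[OF xy(3) ef4(2)] mult_mono[OF xy(4) ef4(1)] mult_mono[OF f2 ef4(1)] ef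
    by (simp_all flip: power_add)
  have "k1 * k2 - x * y / 4 = x * f / 2 + y * e / 2 + f * e"
    by (simp add: e_def f_def field_simps)
  moreover have "0 \<le> x * f" "0 \<le> y * e" "0 \<le> f * e" using xy ef by auto
  ultimately have d: "\<bar>k1 * k2 - x * y / 4\<bar> \<le> 2 * M ^ 6" using b by linarith
  have "leading_angle (1 + k1) (1 + k2) \<phi> - x * y / 16 * sin (2 * \<phi>) = (k1 * k2 - x * y / 4) * (sin (2 * \<phi>) / 4)"
    by (simp add: leading_angle_def algebra_simps)
  also have "\<bar>\<dots>\<bar> \<le> 2 * M ^ 6 * 1"
    unfolding abs_mult using d abs_sin_le_one[of "2 * \<phi>"] by (intro mult_mono) (auto simp del: abs_sin_le_one)
  finally show ?thesis by (simp add: x_def y_def)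
qed

lemma X_le_2: "X \<le> 2"
proof -
  have "0 \<le> (E1 - E2)\<^sup>2" "0 \<le> (s1 - s2)\<^sup>2" by simp_all
  then have "2 * (E1 * E2) \<le> E1 * E1 + E2 * E2" "2 * (s1 * s2) \<le> s1\<^sup>2 + s2\<^sup>2"
    by (simp_all add: power2_eq_square algebra_simps)
  moreover have "s1 * s2 * cos \<phi> \<le> s1 * s2 * 1" using s_pos by (intro mult_left_mono) auto
  ultimately show ?thesis
    using E_square s_square k_le M_square unfolding X_def power2_eq_square[symmetric] by linarith
qed

lemma s_bounds: "b1 / 2 \<le> s1" "b2 / 2 \<le> s2" "s1 \<le> b1" "s2 \<le> b2"
proof -
  have "(b1 / 2)\<^sup>2 \<le> s1\<^sup>2" "(b2 / 2)\<^sup>2 \<le> s2\<^sup>2" "s1\<^sup>2 \<le> b1\<^sup>2" "s2\<^sup>2 \<le> b2\<^sup>2"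
    using k_bounds k_pos by (simp_all add: s_square power_divide)
  then show "b1 / 2 \<le> s1" "b2 / 2 \<le> s2" "s1 \<le> b1" "s2 \<le> b2"
    using s_pos b_pos by (auto intro: power2_le_imp_le)
qed

text \<open>\<open>Y\<close> lies between a quarter of \<open>b1 b2 sin \<phi>\<close> and the
  whole, \<open>X\<close> between 1 and 2, and arctan t between t/2 and t. In the constant 8, a
  factor 4 comes from \<open>Y\<close> and a factor 2 from \<open>X\<close>; the 2 in
  \<open>tw\<close> offsets the loss in arctan.\<close>

lemma tw_upper: "tw \<le> 2 * (b1 * b2 * sin \<phi>)" and tw_lower: "b1 * b2 * sin \<phi> / 8 \<le> tw"
proof -
  have Y: "0 \<le> Y" using s_pos sin_phi_nonneg by (simp add: Y_def)
  have Yb: "Y \<le> b1 * b2 * sin \<phi>"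
    unfolding Y_def using s_bounds s_pos b_pos sin_phi_nonneg by (intro mult_right_mono mult_mono) auto
  have "b1 / 2 * (b2 / 2) * sin \<phi> \<le> Y"
    unfolding Y_def using s_bounds s_pos b_pos sin_phi_nonneg by (intro mult_right_mono mult_mono) auto
  then have bY: "b1 * b2 * sin \<phi> / 4 \<le> Y" by simp
  have "Y / X \<le> Y / 1" using X_ge_1 Y by (intro divide_left_mono) auto
  then have YX: "Y / X \<le> Y" by simp
  have YX0: "0 \<le> Y / X" using Y X_ge_1 by simp
  show "tw \<le> 2 * (b1 * b2 * sin \<phi>)"
    using arctan_le_self[OF YX0] YX Yb by (simp add: tw_def)
  have "b1 * b2 * sin \<phi> \<le> 1 * 1 * 1 / 2"
  proof -
    have "b1 * b2 * sin \<phi> \<le> (1 / 2) * 1 * 1"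
      using b_le M_small b_pos sin_phi_nonneg by (intro mult_mono) auto
    then show ?thesis by simp
  qed
  then have "Y / X < 1" using YX Yb by linarith
  then have "Y / X \<le> tw" using arctan_ge_half[OF YX0] by (simp add: tw_def)
  moreover have "Y / 2 \<le> Y / X" using X_le_2 X_ge_1 Y by (intro divide_left_mono) auto
  ultimately show "b1 * b2 * sin \<phi> / 8 \<le> tw" using bY by linarith
qed

lemma angle_le_tw: "\<bar>angle\<bar> \<le> 4 * M\<^sup>2 * tw"
proof -
  have "k1 * k2 * sin \<phi> \<le> b1\<^sup>2 * b2\<^sup>2 * sin \<phi>"
    using k_bounds k_pos sin_phi_nonneg by (intro mult_right_mono mult_mono) auto
  then have "\<bar>angle\<bar> \<le> b1\<^sup>2 * b2\<^sup>2 * sin \<phi> / 2" using angle_le by linarith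
  \<comment> \<open>One factor is exactly the lower bound for \<open>tw\<close>; the spare
    \<open>b1 b2\<close> is the gain of order \<open>M^2\<close>.\<close>
  also have "\<dots> = 4 * (b1 * b2) * (b1 * b2 * sin \<phi> / 8)" by (simp add: power2_eq_square)
  also have "\<dots> \<le> 4 * (M * M) * tw"
    using tw_lower b_le b_pos sin_phi_nonneg M_pos by (intro mult_mono) auto
  finally show ?thesis by (simp add: power2_eq_square)
qed

lemma tw_bounds: "0 \<le> tw" "tw \<le> 2 * M\<^sup>2"
proof -
  show "0 \<le> tw" using tw_lower b_pos sin_phi_nonneg
    by (meson divide_nonneg_pos less_imp_le mult_nonneg_nonneg order_trans zero_less_numeral)
  have "b1 * b2 * sin \<phi> \<le> M * M * 1"
    using b_le b_pos sin_phi_nonneg M_pos by (intro mult_mono) auto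
  then show "tw \<le> 2 * M\<^sup>2" using tw_upper by (simp add: power2_eq_square)
qed

end

end

section \<open>Asymptotics\<close>

lemma boost_pair_exists:
  fixes u1 u2 :: "real^'n::finite"
  assumes "2 \<le> CARD('n)" "0 < c" "(u1, u2) \<in> steps c"
  obtains e1 e2 where "boost_pair e1 e2 u1 u2 (angle_between u1 u2) c
    (lorentz_factor c u1 - 1) (lorentz_factor c u2 - 1)"
proof -
  obtain e1 e2 where "step_frame e1 e2 u1 u2 (angle_between u1 u2)"
    using step_frame_exists[of u1 u2] assms by (auto simp: steps_def)
  then have "boost_pair e1 e2 u1 u2 (angle_between u1 u2) c (lorentz_factor c u1 - 1) (lorentz_factor c u2 - 1)"
    using assms by (auto simp: boost_pair_def boost_pair_axioms_def steps_def)
  then show thesis by (rule that)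
qed

lemma eventually_mach_to_0:
  assumes "0 < \<delta>" "\<And>u1 u2. (u1, u2) \<in> S \<Longrightarrow> mach c u1 u2 < \<delta> \<Longrightarrow> P (u1, u2)"
  shows "eventually P (mach_to_0 c S)"
proof -
  have "eventually (\<lambda>x. x < \<delta>) (nhds (0::real))"
    using assms(1) eventually_nhds by (metis lessThan_iff open_lessThan)
  then show ?thesis
    unfolding mach_to_0_def eventually_inf_principal eventually_filtercomap
    using assms(2) by (intro exI[of _ "\<lambda>x. x < \<delta>"]) auto
qed

lemma bigo_mach_to_0:
  fixes f g :: "real^'n::finite \<Rightarrow> real^'n \<Rightarrow> real"
  assumes "\<And>u1 u2. (u1, u2) \<in> S \<Longrightarrow> mach c u1 u2 < 1 / 8 \<Longrightarrow> \<bar>f u1 u2\<bar> \<le> K * \<bar>g u1 u2\<bar>"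
  shows "(\<lambda>(u1, u2). f u1 u2) \<in> O[mach_to_0 c S](\<lambda>(u1, u2). g u1 u2)"
  by (rule bigoI[of _ K], rule eventually_mach_to_0[of "1 / 8"]) (auto intro: assms)

lemma admissible_steps_q00: "(u1, u2) \<in> admissible_steps c \<Longrightarrow> (u1, u2) \<in> steps c \<and> 0 < q00 c u1 u2"
  by (simp add: admissible_steps_def admissible_endpoint_def)

section \<open>Vanishing and maximality in the angle between the steps\<close>

lemma sin_double_maximal:
  assumes "0 \<le> \<phi>" "\<phi> \<le> pi" "\<phi> \<noteq> pi / 4"
  shows "sin (2 * \<phi>) < 1"
proof (rule ccontr)
  assume "\<not> sin (2 * \<phi>) < 1"
  then have "sin (2 * \<phi>) = 1" using sin_le_one[of "2 * \<phi>"] by linarith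
  then have "sin (2 * \<phi>) = sin (pi / 2) \<and> cos (2 * \<phi>) = cos (pi / 2)"
    using sin_cos_squared_add[of "2 * \<phi>"] by simp
  then obtain n :: int where n: "2 * \<phi> = pi / 2 + 2 * pi * n"
    using sin_cos_eq_iff by blast
  have "\<bar>2 * pi * n\<bar> < 2 * pi" using n assms pi_gt_zero by linarith
  then have "\<bar>real_of_int n\<bar> < 1" by (simp add: abs_mult)
  then have "n = 0" by linarith
  with n assms show False by simp
qed

lemma leading_angle_maximal:
  assumes "1 < g1" "1 < g2" "0 \<le> \<phi>" "\<phi> \<le> pi" "\<phi> \<noteq> pi / 4"
  shows "leading_angle g1 g2 \<phi> < leading_angle g1 g2 (pi / 4)"
proof -
  have "sin (2 * (pi / 4)) = 1" by simp
  then show ?thesis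
    using sin_double_maximal[OF assms(3-5)] assms(1,2) by (simp add: leading_angle_def)
qed

context boost_pair
begin

lemma angle_vanishes:
  assumes "collinear {0, u1, u2} \<or> orthogonal u1 u2"
  shows "angle = 0"
proof -
  have "sin \<phi> = 0 \<or> cos \<phi> = 0"
    using assms
  proof
    assume "collinear {0, u1, u2}"
    then obtain a where "u2 = a *\<^sub>R u1"
      using u1_nonzero u2_nonzero by (auto simp: collinear_lemma)
    moreover have "e2 \<bullet> u1 = 0" by (subst u1) (simp add: e21)
    ultimately have "e2 \<bullet> u2 = 0" by simp
    moreover have "e2 \<bullet> u2 = norm u2 * sin \<phi>" by (subst u2) (simp add: frame_inner)
    ultimately show ?thesis using u2_nonzero by simp
  next
    assume "orthogonal u1 u2"
    then have "u1 \<bullet> u2 = 0" by (simp add: orthogonal_def)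
    moreover have "u1 \<bullet> u2 = norm u1 * (norm u2 * cos \<phi>)"
      by (subst u1, subst u2) (simp add: frame_inner)
    ultimately show ?thesis using u1_nonzero u2_nonzero by simp
  qed
  then show ?thesis by (auto simp: angle_def holonomy_tan_def)
qed

text \<open>The competitor for maximality: the second step is turned within the frame, so
  \<open>k1\<close> and \<open>k2\<close> are unchanged and only \<phi> differs.\<close>

lemma boost_pair_at_pi_4:
  obtains v where "norm v = norm u2" "boost_pair e1 e2 u1 v (pi / 4) c k1 k2"
proof -
  define v where "v = norm u2 *\<^sub>R (cos (pi / 4) *\<^sub>R e1 + sin (pi / 4) *\<^sub>R e2)"
  have "norm (cos (pi / 4) *\<^sub>R e1 + sin (pi / 4) *\<^sub>R e2) = 1"
    using frame_norm[of "cos (pi / 4)" "sin (pi / 4)"]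
    by (smt (verit) norm_ge_zero power2_eq_1_iff sin_cos_squared_add2)
  then have nv: "norm v = norm u2" by (simp add: v_def)
  have "lorentz_factor c v = lorentz_factor c u2" by (simp add: lorentz_factor_def nv)
  then have "boost_pair e1 e2 u1 v (pi / 4) c k1 k2"
    using u1 u1_nonzero u2_nonzero c u1_less u2_less k1 k2 nv v_def
    by unfold_locales auto
  with nv show thesis by (rule that)
qed

text \<open>Comparing \<open>N / D\<close> with its value at \<pi>/4 and cancelling
  \<open>k1 k2 / 2\<close> leaves \<open>sin (2 \<phi>)\<close> at least the ratio of the two
  denominators. This ratio is at least \<open>2 / (2 + 3 M^2)\<close>.\<close>

lemma maximizing_sin:
  assumes max: "(u1, u2) \<in> maximizing_steps c" and small: "mach c u1 u2 < 1 / 8"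
  shows "1 - 2 * (mach c u1 u2)\<^sup>2 \<le> sin (2 * \<phi>)"
proof -
  define M where "M = mach c u1 u2"
  note k_le = k_le[OF M_def small[folded M_def]] and M_square = M_square[OF M_def small[folded M_def]]
  obtain v where v: "norm v = norm u2" "boost_pair e1 e2 u1 v (pi / 4) c k1 k2"
    using boost_pair_at_pi_4 by blast
  interpret v: boost_pair e1 e2 u1 v "pi / 4" c k1 k2 by (fact v(2))
  have "mach c u1 v = mach c u1 u2" by (simp add: mach_def v(1))
  \<comment> \<open>Small speed makes the competitor an element of \<open>admissible_steps\<close>,
    so that maximality applies to it.\<close>
  then have qv: "0 < q00 c u1 v" using v.q00_pos_small[OF refl] small by simp
  have "(u1, v) \<in> admissible_steps c"
    using v.holonomy_boost_pair(1)[OF qv] u1_less u1_nonzero v.u2_nonzero v.u2_less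
    by (simp add: admissible_steps_def steps_def)
  then have "holonomy_angle c u1 v \<le> holonomy_angle c u1 u2"
    using max v(1) by (auto simp: maximizing_steps_def)
  moreover have "0 < q00 c u1 u2"
    using max by (simp add: maximizing_steps_def admissible_steps_def admissible_endpoint_def)
  ultimately have "v.angle \<le> angle"
    by (simp add: holonomy_boost_pair(4) v.holonomy_boost_pair(4)[OF qv])
  then have le: "v.N / v.D \<le> N / D"
    by (simp add: angle_def v.angle_def holonomy_tan_def N_def D_def v.N_def v.D_def arctan_le_iff)
  have half: "cos (pi / 4) * sin (pi / 4) = (1::real) / 2"
    using sin_double[of "pi / 4"] by (simp add: mult.commute)
  have Nv: "v.N = k1 * k2 / 2"
    unfolding v.N_def mult.assoc half by simp
  have N: "N = k1 * k2 / 2 * sin (2 * \<phi>)" by (simp add: N_def sin_double)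
  have "k1 * k2 / 2 * (D / v.D) \<le> k1 * k2 / 2 * sin (2 * \<phi>)"
    using le D_pos v.D_pos unfolding Nv N by (simp add: field_simps)
  then have sin: "D / v.D \<le> sin (2 * \<phi>)"
    by (rule mult_left_le_imp_le) (use k_pos in simp)
  have "2 \<le> D" using D_bounds[OF M_def small[folded M_def]] by simp
  then have "2 / v.D \<le> D / v.D" using v.D_pos by (intro divide_right_mono) auto
  moreover have "1 - 2 * M\<^sup>2 \<le> 2 / v.D"
  proof -
    have "k1 * k2 \<le> M\<^sup>2 * 1" using k_le k_pos M_square by (intro mult_mono) auto
    moreover have "v.D \<le> 2 + k1 + k2 + k1 * k2"
      using v.D_bounds[OF refl] small \<open>mach c u1 v = mach c u1 u2\<close> by simp
    ultimately have D: "v.D \<le> 2 + 3 * M\<^sup>2" using k_le by linarith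
    have "(1 - 2 * M\<^sup>2) * v.D \<le> (1 - 2 * M\<^sup>2) * (2 + 3 * M\<^sup>2)"
      using D M_square by (intro mult_left_mono) auto
    also have "\<dots> \<le> 2"
      using zero_le_power2[of M] mult_nonneg_nonneg[of "M\<^sup>2" "M\<^sup>2"] by (simp add: algebra_simps)
    finally show ?thesis using v.D_pos by (simp add: field_simps)
  qed
  ultimately show ?thesis using sin unfolding M_def by linarith
qed

end

text \<open>A positive \<open>sin (2 \<phi>)\<close> excludes \<phi> beyond \<pi>/2, so
  \<open>2 \<phi> - \<pi>/2\<close> is small enough in absolute value for arccos to invert the
  cosine.\<close>

lemma abs_angle_diff_arccos:
  assumes "0 \<le> \<phi>" "\<phi> \<le> pi" "0 < sin (2 * \<phi>)"
  shows "\<bar>\<phi> - pi / 4\<bar> = arccos (sin (2 * \<phi>)) / 2"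
proof -
  have "\<phi> \<le> pi / 2"
  proof (rule ccontr)
    assume "\<not> \<phi> \<le> pi / 2"
    then have "0 \<le> sin (2 * \<phi> - pi)" using assms(1,2) by (intro sin_ge_zero) auto
    then show False using assms(3) by simp
  qed
  then have "\<bar>2 * \<phi> - pi / 2\<bar> \<le> pi" using assms(1) by linarith
  moreover have "cos \<bar>2 * \<phi> - pi / 2\<bar> = sin (2 * \<phi>)"
    by (simp add: cos_diff)
  ultimately have "arccos (sin (2 * \<phi>)) = \<bar>2 * \<phi> - pi / 2\<bar>"
    using arccos_cos[of "\<bar>2 * \<phi> - pi / 2\<bar>"] by simp
  then show ?thesis by (simp add: abs_if field_simps)
qed

lemma maximizing_angle_tendsto:
  assumes d: "2 \<le> CARD('n::finite)" and c: "0 < c"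
  shows "((\<lambda>(u1 :: real^'n, u2). angle_between u1 u2) \<longlongrightarrow> pi / 4) (mach_to_0 c (maximizing_steps c))"
proof -
  let ?F = "mach_to_0 c (maximizing_steps c :: ((real^'n) \<times> (real^'n)) set)"
  have bound: "1 - 2 * (mach c u1 u2)\<^sup>2 \<le> sin (2 * angle_between u1 u2)"
    if max: "(u1, u2) \<in> maximizing_steps c" and small: "mach c u1 u2 < 1 / 8" for u1 u2 :: "real^'n"
  proof -
    have "(u1, u2) \<in> steps c" using max by (simp add: maximizing_steps_def admissible_steps_def)
    then obtain e1 e2 where "boost_pair e1 e2 u1 u2 (angle_between u1 u2) c
        (lorentz_factor c u1 - 1) (lorentz_factor c u2 - 1)"
      using boost_pair_exists[OF d c] by blast
    then show ?thesis using max small by (rule boost_pair.maximizing_sin)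
  qed
  have mach: "((\<lambda>(u1, u2). mach c u1 u2) \<longlongrightarrow> 0) ?F"
    unfolding tendsto_iff
    by (auto intro!: eventually_mach_to_0 simp: mach_bounds(3)[OF c] abs_of_nonneg)
  have "((\<lambda>(u1, u2). sin (2 * angle_between u1 u2)) \<longlongrightarrow> 1) ?F"
  proof (rule tendsto_sandwich)
    show "((\<lambda>u. 1 - 2 * (case u of (u1, u2) \<Rightarrow> mach c u1 u2)\<^sup>2) \<longlongrightarrow> 1) ?F"
      using mach by (auto intro!: tendsto_eq_intros)
    show "\<forall>\<^sub>F u in ?F. 1 - 2 * (case u of (u1, u2) \<Rightarrow> mach c u1 u2)\<^sup>2
        \<le> (case u of (u1, u2) \<Rightarrow> sin (2 * angle_between u1 u2))"
      by (rule eventually_mach_to_0[of "1 / 8"]) (simp_all add: bound)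
    show "\<forall>\<^sub>F u in ?F. (case u of (u1, u2) \<Rightarrow> sin (2 * angle_between u1 u2)) \<le> 1"
      by (simp add: case_prod_beta)
  qed simp
  then have "((\<lambda>u. arccos (case u of (u1, u2) \<Rightarrow> sin (2 * angle_between u1 u2))) \<longlongrightarrow> arccos 1) ?F"
    by (rule continuous_on_tendsto_compose[OF continuous_on_arccos']) (auto simp: case_prod_beta)
  then have lim: "((\<lambda>u. arccos (case u of (u1, u2) \<Rightarrow> sin (2 * angle_between u1 u2)) / 2) \<longlongrightarrow> 0) ?F"
    by (auto intro!: tendsto_eq_intros)
  have "\<forall>\<^sub>F u in ?F. arccos (case u of (u1, u2) \<Rightarrow> sin (2 * angle_between u1 u2)) / 2
      = \<bar>(case u of (u1, u2) \<Rightarrow> angle_between u1 u2) - pi / 4\<bar>"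
  proof (rule eventually_mach_to_0[of "1 / 8"])
    fix u1 u2 :: "real^'n" assume u: "(u1, u2) \<in> maximizing_steps c" "mach c u1 u2 < 1 / 8"
    have "(mach c u1 u2)\<^sup>2 \<le> (1 / 8)\<^sup>2" using u(2) mach_bounds[OF c] by (intro power_mono) auto
    then have "0 < sin (2 * angle_between u1 u2)" using bound[OF u] by (simp add: power2_eq_square)
    then show "arccos (case (u1, u2) of (u1, u2) \<Rightarrow> sin (2 * angle_between u1 u2)) / 2
        = \<bar>(case (u1, u2) of (u1, u2) \<Rightarrow> angle_between u1 u2) - pi / 4\<bar>"
      by (simp add: abs_angle_diff_arccos angle_between_cos)
  qed simp
  then have "((\<lambda>u. \<bar>(case u of (u1, u2) \<Rightarrow> angle_between u1 u2) - pi / 4\<bar>) \<longlongrightarrow> 0) ?F"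
    using lim by (rule Lim_transform_eventually[rotated])
  then show ?thesis unfolding tendsto_rabs_zero_iff by (rule LIM_zero_cancel)
qed

section \<open>Comparison with the Thomas--Wigner angle\<close>

lemma mach_scaleR: "0 < s \<Longrightarrow> mach c (s *\<^sub>R a1) (s *\<^sub>R a2) = s * mach c a1 a2"
  by (simp add: mach_def max_mult_distrib_left)

lemma angle_between_scaleR: "0 < s \<Longrightarrow> angle_between (s *\<^sub>R a1) (s *\<^sub>R a2) = angle_between a1 a2"
  by (simp add: angle_between_def)

text \<open>The order \<open>M^2\<close> is attained along each fixed non-collinear pair of
  directions. A lower bound uniform in the directions is impossible, as the angle vanishes for
  collinear steps.\<close>

lemma thomas_wigner_bigtheta:
  fixes a1 a2 :: "real^'n::finite"
  assumes d: "2 \<le> CARD('n)" and c: "0 < c" and a: "\<not> collinear {0, a1, a2}"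
  shows "(\<lambda>s. thomas_wigner_angle c (s *\<^sub>R a1) (s *\<^sub>R a2))
    \<in> \<Theta>[at_right 0](\<lambda>s. mach c (s *\<^sub>R a1) (s *\<^sub>R a2) ^ 2)"
proof -
  define \<phi> m where "\<phi> = angle_between a1 a2" and "m = mach c a1 a2"
  have nz: "a1 \<noteq> 0" "a2 \<noteq> 0" using a by (auto simp: collinear_lemma)
  have m: "0 < m" using nz c by (simp add: m_def mach_def less_max_iff_disj)
  have small: "0 < s * m \<and> s * m < 1 / 8" if "0 < s" "s < 1 / (8 * m)" for s
    using that m by (simp add: field_simps)
  define K where "K = norm a1 / c * (norm a2 / c) * sin \<phi> / 8"
  have bounds: "K * s\<^sup>2 \<le> thomas_wigner_angle c (s *\<^sub>R a1) (s *\<^sub>R a2)"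
    "0 \<le> thomas_wigner_angle c (s *\<^sub>R a1) (s *\<^sub>R a2)"
    "thomas_wigner_angle c (s *\<^sub>R a1) (s *\<^sub>R a2) \<le> 2 * (s * m)\<^sup>2"
    if s: "0 < s" "s < 1 / (8 * m)" for s
  proof -
    have M: "mach c (s *\<^sub>R a1) (s *\<^sub>R a2) = s * m" using s by (simp add: mach_scaleR m_def)
    then have Ms: "mach c (s *\<^sub>R a1) (s *\<^sub>R a2) < 1 / 8" using small[OF s] by simp
    have "norm (s *\<^sub>R a1) / c < 1" "norm (s *\<^sub>R a2) / c < 1"
      using Ms mach_bounds(1,2)[OF c, where ?u1.0 = "s *\<^sub>R a1" and ?u2.0 = "s *\<^sub>R a2"] by linarith+
    then have "(s *\<^sub>R a1, s *\<^sub>R a2) \<in> steps c" using nz s c by (simp add: steps_def)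
    then obtain e1 e2 where "boost_pair e1 e2 (s *\<^sub>R a1) (s *\<^sub>R a2)
        (angle_between (s *\<^sub>R a1) (s *\<^sub>R a2)) c
        (lorentz_factor c (s *\<^sub>R a1) - 1) (lorentz_factor c (s *\<^sub>R a2) - 1)"
      using boost_pair_exists[OF d c] by blast
    then interpret boost_pair e1 e2 "s *\<^sub>R a1" "s *\<^sub>R a2" \<phi> c
        "lorentz_factor c (s *\<^sub>R a1) - 1" "lorentz_factor c (s *\<^sub>R a2) - 1"
      using s by (simp add: angle_between_scaleR \<phi>_def)
    have "b1 * b2 * sin \<phi> / 8 = K * s\<^sup>2"
      using s by (simp add: K_def b1_def b2_def power2_eq_square)
    then show "K * s\<^sup>2 \<le> thomas_wigner_angle c (s *\<^sub>R a1) (s *\<^sub>R a2)"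
      using tw_lower[OF refl Ms] by (simp add: thomas_wigner_boost_pair)
    show "0 \<le> thomas_wigner_angle c (s *\<^sub>R a1) (s *\<^sub>R a2)"
      "thomas_wigner_angle c (s *\<^sub>R a1) (s *\<^sub>R a2) \<le> 2 * (s * m)\<^sup>2"
      using tw_bounds[OF refl Ms] by (simp_all add: thomas_wigner_boost_pair M)
  qed
  have K: "0 < K"
  proof -
    obtain e1 e2 where "step_frame e1 e2 a1 a2 \<phi>"
      using step_frame_exists[OF d nz] \<phi>_def by blast
    then interpret step_frame e1 e2 a1 a2 \<phi> .
    have "sin \<phi> \<noteq> 0"
    proof
      assume "sin \<phi> = 0"
      then have "a2 = (norm a2 * cos \<phi> / norm a1) *\<^sub>R (norm a1 *\<^sub>R e1)" using u2 nz by simp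
      then have "a2 = (norm a2 * cos \<phi> / norm a1) *\<^sub>R a1" using u1 by simp
      then show False using a by (auto simp: collinear_lemma)
    qed
    then show ?thesis using sin_phi_nonneg nz c by (simp add: K_def)
  qed
  have ev: "eventually (\<lambda>s. 0 < s \<and> s < 1 / (8 * m)) (at_right 0)"
    unfolding eventually_at_right_field using m by (intro exI[of _ "1 / (8 * m)"]) auto
  show ?thesis
  proof (rule bigthetaI)
    show "(\<lambda>s. thomas_wigner_angle c (s *\<^sub>R a1) (s *\<^sub>R a2)) \<in> O[at_right 0](\<lambda>s. mach c (s *\<^sub>R a1) (s *\<^sub>R a2) ^ 2)"
      by (rule bigoI[of _ 2], rule eventually_mono[OF ev])
        (use bounds in \<open>auto simp: mach_scaleR m_def\<close>)
    show "(\<lambda>s. thomas_wigner_angle c (s *\<^sub>R a1) (s *\<^sub>R a2)) \<in> \<Omega>[at_right 0](\<lambda>s. mach c (s *\<^sub>R a1) (s *\<^sub>R a2) ^ 2)"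
    proof (rule landau_omega.bigI[of "K / m\<^sup>2"], use K m in simp, rule eventually_mono[OF ev])
      fix s assume s: "0 < s \<and> s < 1 / (8 * m)"
      have "K / m\<^sup>2 * (s * m)\<^sup>2 = K * s\<^sup>2" using m by (simp add: power_mult_distrib)
      then show "K / m\<^sup>2 * norm (mach c (s *\<^sub>R a1) (s *\<^sub>R a2) ^ 2) \<le> norm (thomas_wigner_angle c (s *\<^sub>R a1) (s *\<^sub>R a2))"
        using s bounds(1,2)[of s] by (simp add: mach_scaleR m_def)
    qed
  qed
qed

lemma holonomy_smallo_thomas_wigner:
  assumes d: "2 \<le> CARD('n::finite)" and c: "0 < c"
  shows "(\<lambda>(u1 :: real^'n, u2). holonomy_angle c u1 u2)
       \<in> o[mach_to_0 c (admissible_steps c)](\<lambda>(u1, u2). thomas_wigner_angle c u1 u2)"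
proof (rule landau_o.smallI)
  fix \<epsilon> :: real assume \<epsilon>: "0 < \<epsilon>"
  show "\<forall>\<^sub>F u in mach_to_0 c (admissible_steps c). norm (case u of (u1 :: real^'n, u2) \<Rightarrow> holonomy_angle c u1 u2)
      \<le> \<epsilon> * norm (case u of (u1, u2) \<Rightarrow> thomas_wigner_angle c u1 u2)"
  \<comment> \<open>One factor of \<open>M^2\<close> is bounded by 1/8 and the other by \<epsilon>,
    so that \<open>4 M^2 \<le> \<epsilon> / 2\<close>.\<close>
  proof (rule eventually_mach_to_0[of "min (1 / 8) \<epsilon>"])
    fix u1 u2 :: "real^'n"
    assume u: "(u1, u2) \<in> admissible_steps c" and M: "mach c u1 u2 < min (1 / 8) \<epsilon>"
    then have adm: "(u1, u2) \<in> steps c" "0 < q00 c u1 u2" using admissible_steps_q00 by blast+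
    then obtain e1 e2 where "boost_pair e1 e2 u1 u2 (angle_between u1 u2) c
        (lorentz_factor c u1 - 1) (lorentz_factor c u2 - 1)"
      using boost_pair_exists[OF d c] by blast
    then interpret boost_pair e1 e2 u1 u2 "angle_between u1 u2" c
      "lorentz_factor c u1 - 1" "lorentz_factor c u2 - 1" .
    have Ms: "mach c u1 u2 < 1 / 8" using M by simp
    have "4 * (mach c u1 u2)\<^sup>2 \<le> 4 * (1 / 8 * \<epsilon>)"
      unfolding power2_eq_square using M mach_bounds[OF c, of u1 u2] by (intro mult_left_mono mult_mono) auto
    also have "\<dots> \<le> \<epsilon>" using \<epsilon> by simp
    finally have "4 * (mach c u1 u2)\<^sup>2 * tw \<le> \<epsilon> * tw"
      using tw_bounds[OF refl Ms] by (intro mult_right_mono) auto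
    then have "\<bar>angle\<bar> \<le> \<epsilon> * tw" using angle_le_tw[OF refl Ms] by linarith
    then show "norm (case (u1, u2) of (u1, u2) \<Rightarrow> holonomy_angle c u1 u2)
      \<le> \<epsilon> * norm (case (u1, u2) of (u1, u2) \<Rightarrow> thomas_wigner_angle c u1 u2)"
      using tw_bounds[OF refl Ms] by (simp add: holonomy_boost_pair(4)[OF adm(2)] thomas_wigner_boost_pair)
  qed (use \<epsilon> in simp)
qed

text \<open>The first conjunct certifies that the definite descriptions behind the rotation and its
  angle denote as intended, so that the others speak about a genuine angle.\<close>

theorem proposition24:
  fixes c :: real
  assumes c: "0 < c"
    and d: "CARD('n::finite) \<in> {2, 3}"
  shows
    "(\<forall>(u1 :: real^'n, u2) \<in> admissible_steps c.
        let R = holonomy_rotation c u1 u2; \<theta> = holonomy_angle c u1 u2 in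
        holonomy c u1 u2 = rho c u1 u2 *\<^sub>R block 1 0 0 R \<and> rotation_matrix R \<and>
        - pi < \<theta> \<and> \<theta> \<le> pi \<and> plane_rotation u1 u2 R \<theta>)
   \<and> (\<lambda>(u1 :: real^'n, u2). holonomy_angle c u1 u2
         - leading_angle (lorentz_factor c u1) (lorentz_factor c u2) (angle_between u1 u2))
       \<in> O[mach_to_0 c (admissible_steps c)](\<lambda>(u1, u2). mach c u1 u2 ^ 6)
   \<and> (\<lambda>(u1 :: real^'n, u2). holonomy_angle c u1 u2
         - (norm u1)\<^sup>2 * (norm u2)\<^sup>2 / (16 * c ^ 4) * sin (2 * angle_between u1 u2))
       \<in> O[mach_to_0 c (admissible_steps c)](\<lambda>(u1, u2). mach c u1 u2 ^ 6)
   \<and> (\<forall>(u1 :: real^'n, u2) \<in> admissible_steps c.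
        collinear {0, u1, u2} \<or> orthogonal u1 u2 \<longrightarrow> holonomy_angle c u1 u2 = 0)
   \<and> (\<forall>(u1 :: real^'n, u2) \<in> steps c. \<forall>\<phi> \<in> {0..pi}. \<phi> \<noteq> pi / 4 \<longrightarrow>
        leading_angle (lorentz_factor c u1) (lorentz_factor c u2) \<phi>
          < leading_angle (lorentz_factor c u1) (lorentz_factor c u2) (pi / 4))
   \<and> ((\<lambda>(u1 :: real^'n, u2). angle_between u1 u2) \<longlongrightarrow> pi / 4) (mach_to_0 c (maximizing_steps c))
   \<and> (\<lambda>(u1 :: real^'n, u2). holonomy_angle c u1 u2)
       \<in> O[mach_to_0 c (admissible_steps c)](\<lambda>(u1, u2). mach c u1 u2 ^ 4)
   \<and> (\<lambda>(u1 :: real^'n, u2). thomas_wigner_angle c u1 u2)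
       \<in> O[mach_to_0 c (steps c)](\<lambda>(u1, u2). mach c u1 u2 ^ 2)
   \<and> (\<forall>a1 a2 :: real^'n. \<not> collinear {0, a1, a2} \<longrightarrow>
        (\<lambda>s. thomas_wigner_angle c (s *\<^sub>R a1) (s *\<^sub>R a2))
          \<in> \<Theta>[at_right 0](\<lambda>s. mach c (s *\<^sub>R a1) (s *\<^sub>R a2) ^ 2))
   \<and> (\<lambda>(u1 :: real^'n, u2). holonomy_angle c u1 u2)
       \<in> o[mach_to_0 c (admissible_steps c)](\<lambda>(u1, u2). thomas_wigner_angle c u1 u2)"
proof -
  have d2: "2 \<le> CARD('n)" using d by auto
  have steps: "\<exists>e1 e2. boost_pair e1 e2 u1 u2 (angle_between u1 u2) c
      (lorentz_factor c u1 - 1) (lorentz_factor c u2 - 1)"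
    if "(u1, u2) \<in> steps c" for u1 u2 :: "real^'n"
    using boost_pair_exists[OF d2 c that] by blast
  have exact: "holonomy c u1 u2 = rho c u1 u2 *\<^sub>R block 1 0 0 (holonomy_rotation c u1 u2)
      \<and> rotation_matrix (holonomy_rotation c u1 u2)
      \<and> - pi < holonomy_angle c u1 u2 \<and> holonomy_angle c u1 u2 \<le> pi
      \<and> plane_rotation u1 u2 (holonomy_rotation c u1 u2) (holonomy_angle c u1 u2)"
    and zero: "collinear {0, u1, u2} \<or> orthogonal u1 u2 \<Longrightarrow> holonomy_angle c u1 u2 = 0"
    if u: "(u1, u2) \<in> admissible_steps c" for u1 u2 :: "real^'n"
  proof -
    have adm: "(u1, u2) \<in> steps c" and q: "0 < q00 c u1 u2" using u admissible_steps_q00 by blast+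
    from steps[OF adm] obtain e1 e2 where "boost_pair e1 e2 u1 u2 (angle_between u1 u2) c
      (lorentz_factor c u1 - 1) (lorentz_factor c u2 - 1)" by blast
    then interpret boost_pair e1 e2 u1 u2 "angle_between u1 u2" c
      "lorentz_factor c u1 - 1" "lorentz_factor c u2 - 1" .
    note hol = holonomy_boost_pair[OF q]
    show "holonomy c u1 u2 = rho c u1 u2 *\<^sub>R block 1 0 0 (holonomy_rotation c u1 u2)
      \<and> rotation_matrix (holonomy_rotation c u1 u2)
      \<and> - pi < holonomy_angle c u1 u2 \<and> holonomy_angle c u1 u2 \<le> pi
      \<and> plane_rotation u1 u2 (holonomy_rotation c u1 u2) (holonomy_angle c u1 u2)"
      unfolding hol(3,4) using hol(2) rotation_planar_rot angle_bounds plane_rotation_frame by blast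
    show "collinear {0, u1, u2} \<or> orthogonal u1 u2 \<Longrightarrow> holonomy_angle c u1 u2 = 0"
      unfolding hol(4) by (rule angle_vanishes)
  qed
  have lead: "\<bar>holonomy_angle c u1 u2 - leading_angle (lorentz_factor c u1) (lorentz_factor c u2) (angle_between u1 u2)\<bar>
        \<le> 2 * \<bar>mach c u1 u2 ^ 6\<bar>"
    and mach6: "\<bar>holonomy_angle c u1 u2 - (norm u1)\<^sup>2 * (norm u2)\<^sup>2 / (16 * c ^ 4) * sin (2 * angle_between u1 u2)\<bar>
        \<le> 4 * \<bar>mach c u1 u2 ^ 6\<bar>"
    and mach4: "\<bar>holonomy_angle c u1 u2\<bar> \<le> 1 * \<bar>mach c u1 u2 ^ 4\<bar>"
    if u: "(u1, u2) \<in> admissible_steps c" and M: "mach c u1 u2 < 1 / 8" for u1 u2 :: "real^'n"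
  proof -
    have adm: "(u1, u2) \<in> steps c" and q: "0 < q00 c u1 u2" using u admissible_steps_q00 by blast+
    from steps[OF adm] obtain e1 e2 where "boost_pair e1 e2 u1 u2 (angle_between u1 u2) c
      (lorentz_factor c u1 - 1) (lorentz_factor c u2 - 1)" by blast
    then interpret boost_pair e1 e2 u1 u2 "angle_between u1 u2" c
      "lorentz_factor c u1 - 1" "lorentz_factor c u2 - 1" .
    note hol = holonomy_boost_pair(4)[OF q]
    have nn: "0 \<le> mach c u1 u2" by (rule mach_bounds[OF c])
    then have n6: "\<bar>mach c u1 u2 ^ 6\<bar> = mach c u1 u2 ^ 6" by simp
    have lead0: "\<bar>angle - leading_angle (lorentz_factor c u1) (lorentz_factor c u2) (angle_between u1 u2)\<bar>
        \<le> 2 * mach c u1 u2 ^ 6"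
      using angle_leading[OF refl M] by simp
    then show "\<bar>holonomy_angle c u1 u2 - leading_angle (lorentz_factor c u1) (lorentz_factor c u2) (angle_between u1 u2)\<bar>
        \<le> 2 * \<bar>mach c u1 u2 ^ 6\<bar>"
      unfolding hol n6 .
    have "b1\<^sup>2 * b2\<^sup>2 / 16 = (norm u1)\<^sup>2 * (norm u2)\<^sup>2 / (16 * c ^ 4)"
      by (simp add: b1_def b2_def power_divide flip: power_add)
    then have "\<bar>leading_angle (lorentz_factor c u1) (lorentz_factor c u2) (angle_between u1 u2)
        - (norm u1)\<^sup>2 * (norm u2)\<^sup>2 / (16 * c ^ 4) * sin (2 * angle_between u1 u2)\<bar> \<le> 2 * mach c u1 u2 ^ 6"
      using leading_expansion[OF refl M] by simp
    then show "\<bar>holonomy_angle c u1 u2 - (norm u1)\<^sup>2 * (norm u2)\<^sup>2 / (16 * c ^ 4) * sin (2 * angle_between u1 u2)\<bar>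
        \<le> 4 * \<bar>mach c u1 u2 ^ 6\<bar>"
      using lead0 unfolding hol n6 by linarith
    show "\<bar>holonomy_angle c u1 u2\<bar> \<le> 1 * \<bar>mach c u1 u2 ^ 4\<bar>"
      using angle_le_M4[OF refl M] by (simp add: hol)
  qed
  have tw: "\<bar>thomas_wigner_angle c u1 u2\<bar> \<le> 2 * \<bar>mach c u1 u2 ^ 2\<bar>"
    if u: "(u1, u2) \<in> steps c" and M: "mach c u1 u2 < 1 / 8" for u1 u2 :: "real^'n"
  proof -
    from steps[OF u] obtain e1 e2 where "boost_pair e1 e2 u1 u2 (angle_between u1 u2) c
      (lorentz_factor c u1 - 1) (lorentz_factor c u2 - 1)" by blast
    then interpret boost_pair e1 e2 u1 u2 "angle_between u1 u2" c
      "lorentz_factor c u1 - 1" "lorentz_factor c u2 - 1" .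
    show ?thesis using tw_bounds[OF refl M] by (simp add: thomas_wigner_boost_pair)
  qed
  show ?thesis
  proof (intro conjI)
    show "\<forall>(u1 :: real^'n, u2) \<in> admissible_steps c.
        let R = holonomy_rotation c u1 u2; \<theta> = holonomy_angle c u1 u2 in
        holonomy c u1 u2 = rho c u1 u2 *\<^sub>R block 1 0 0 R \<and> rotation_matrix R \<and>
        - pi < \<theta> \<and> \<theta> \<le> pi \<and> plane_rotation u1 u2 R \<theta>"
      unfolding Let_def using exact by blast
    show "\<forall>(u1 :: real^'n, u2) \<in> admissible_steps c.
        collinear {0, u1, u2} \<or> orthogonal u1 u2 \<longrightarrow> holonomy_angle c u1 u2 = 0"
      using zero by blast
    show "\<forall>(u1 :: real^'n, u2) \<in> steps c. \<forall>\<phi> \<in> {0..pi}. \<phi> \<noteq> pi / 4 \<longrightarrow>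
        leading_angle (lorentz_factor c u1) (lorentz_factor c u2) \<phi>
          < leading_angle (lorentz_factor c u1) (lorentz_factor c u2) (pi / 4)"
      using c by (auto simp: steps_def intro!: leading_angle_maximal lorentz_factor_gt_1)
    show "\<forall>a1 a2 :: real^'n. \<not> collinear {0, a1, a2} \<longrightarrow>
        (\<lambda>s. thomas_wigner_angle c (s *\<^sub>R a1) (s *\<^sub>R a2))
          \<in> \<Theta>[at_right 0](\<lambda>s. mach c (s *\<^sub>R a1) (s *\<^sub>R a2) ^ 2)"
      using thomas_wigner_bigtheta[OF d2 c] by blast
    show "(\<lambda>(u1 :: real^'n, u2). holonomy_angle c u1 u2
         - leading_angle (lorentz_factor c u1) (lorentz_factor c u2) (angle_between u1 u2))
       \<in> O[mach_to_0 c (admissible_steps c)](\<lambda>(u1, u2). mach c u1 u2 ^ 6)"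
      by (rule bigo_mach_to_0) (rule lead)
    show "(\<lambda>(u1 :: real^'n, u2). holonomy_angle c u1 u2
         - (norm u1)\<^sup>2 * (norm u2)\<^sup>2 / (16 * c ^ 4) * sin (2 * angle_between u1 u2))
       \<in> O[mach_to_0 c (admissible_steps c)](\<lambda>(u1, u2). mach c u1 u2 ^ 6)"
      by (rule bigo_mach_to_0) (rule mach6)
    show "(\<lambda>(u1 :: real^'n, u2). holonomy_angle c u1 u2)
       \<in> O[mach_to_0 c (admissible_steps c)](\<lambda>(u1, u2). mach c u1 u2 ^ 4)"
      by (rule bigo_mach_to_0) (rule mach4)
    show "(\<lambda>(u1 :: real^'n, u2). thomas_wigner_angle c u1 u2)
       \<in> O[mach_to_0 c (steps c)](\<lambda>(u1, u2). mach c u1 u2 ^ 2)"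
      by (rule bigo_mach_to_0) (rule tw)
  qed (fact maximizing_angle_tendsto[OF d2 c] holonomy_smallo_thomas_wigner[OF d2 c])+
qed

end
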